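(* Let $F=g/\omega$ be a Kropina metric on a manifold $M$ whose 1-form $\omega$ is closed. Then there exists an affine connection $\nabla=(\Gamma_{ij}{}^k)$ on $M$ such that each geodesic of $F$ is a geodesic of $\nabla$ (as unparameterized curves).
   Context: A Kropina metric on a manifold $M$ is a function $F(x,\xi)=g_x(\xi,\xi)/\omega_x(\xi)$, defined for $\xi\in T_xM$ with $\omega(\xi)\neq0$, where $\omega$ is a nowhere vanishing 1-form and $g$ is a symmetric 2-tensor field of arbitrary signature, possibly degenerate but with non-degenerate restriction to $\ker\omega$. A geodesic of $F$ is a smooth regular curve $\gamma(t)$ which solves the Euler-Lagrange equation of the Lagrangian $F$ and satisfies $\omega(\gamma'(t))\neq0$ for all $t$. Geodesics (of $F$ and of $\nabla$) are considered without preferred parameterization. All objects are assumed sufficiently smooth. *)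

theory Defs
  imports "HOL-Analysis.Analysis"
begin

section \<open>Smooth maps on open subsets of Euclidean spaces\<close>

text \<open>\<open>Ck_on k S f\<close> is only meant for open \<open>S\<close>.  It says that all iterated directional
  derivatives of \<open>f\<close> up to order \<open>k\<close> exist on \<open>S\<close> and are continuous.\<close>

primrec Ck_on ::
  "nat \<Rightarrow> 'a::euclidean_space set \<Rightarrow> ('a \<Rightarrow> 'b::real_normed_vector) \<Rightarrow> bool" where
  "Ck_on 0 S f \<longleftrightarrow> continuous_on S f"
| "Ck_on (Suc k) S f \<longleftrightarrow>
     (\<forall>x\<in>S. f differentiable (at x)) \<and>
     (\<forall>v. Ck_on k S (\<lambda>x. frechet_derivative f (at x) v))"

definition smooth_on :: "'a::euclidean_space set \<Rightarrow> ('a \<Rightarrow> 'b::real_normed_vector) \<Rightarrow> bool" where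
  "smooth_on S f \<longleftrightarrow> (\<forall>k. Ck_on k S f)"

definition partial :: "'n::finite \<Rightarrow> (real^'n \<Rightarrow> 'b::real_normed_vector) \<Rightarrow> real^'n \<Rightarrow> 'b" where
  "partial i f x = frechet_derivative f (at x) (axis i 1)"


section \<open>Smooth manifolds\<close>

text \<open>A manifold of dimension \<open>CARD('n)\<close> is a Hausdorff, second countable topological space,
  given by the type \<open>'m\<close>, with a smooth (not necessarily maximal) atlas.  A chart \<open>(U, \<phi>)\<close>
  consists of an open domain \<open>U\<close> and a coordinate map \<open>\<phi>\<close>; the values of \<open>\<phi>\<close> outside \<open>U\<close>
  are irrelevant.\<close>

type_synonym ('m, 'n) chart = "'m set \<times> ('m \<Rightarrow> real^'n)"

abbreviation dom :: "('m, 'n::finite) chart \<Rightarrow> 'm set" where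
  "dom c \<equiv> fst c"

abbreviation coord :: "('m, 'n::finite) chart \<Rightarrow> 'm \<Rightarrow> real^'n" where
  "coord c \<equiv> snd c"

definition img :: "('m, 'n::finite) chart \<Rightarrow> (real^'n) set" where
  "img c = coord c ` dom c"

definition transition ::
  "('m, 'n::finite) chart \<Rightarrow> ('m, 'n) chart \<Rightarrow> real^'n \<Rightarrow> real^'n" where
  "transition c d = coord d \<circ> inv_into (dom c) (coord c)"

definition smooth_atlas ::
  "('m::{t2_space, second_countable_topology}, 'n::finite) chart set \<Rightarrow> bool" where
  "smooth_atlas A \<longleftrightarrow>
     (\<Union>c\<in>A. dom c) = UNIV \<and>
     (\<forall>c\<in>A. open (dom c) \<and> open (img c) \<and>
        homeomorphism (dom c) (img c) (coord c) (inv_into (dom c) (coord c))) \<and>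
     (\<forall>c\<in>A. \<forall>d\<in>A. smooth_on (coord c ` (dom c \<inter> dom d)) (transition c d))"


section \<open>Tensor fields and affine connections\<close>

text \<open>Tensor fields and connections are given by their components in the charts of the atlas,
  as functions of the coordinates, subject to the classical transformation laws.  Here
  \<open>transition_partial c d i a x\<close> is $\partial y^a/\partial x^i$, with \<open>x\<close> the coordinates of
  \<open>c\<close> and \<open>y\<close> those of \<open>d\<close>.\<close>

definition transition_partial ::
  "('m, 'n::finite) chart \<Rightarrow> ('m, 'n) chart \<Rightarrow> 'n \<Rightarrow> 'n \<Rightarrow> real^'n \<Rightarrow> real" where
  "transition_partial c d i a x = partial i (\<lambda>z. transition c d z $ a) x"

definition one_form ::
  "('m, 'n::finite) chart set \<Rightarrow> (('m, 'n) chart \<Rightarrow> real^'n \<Rightarrow> real^'n) \<Rightarrow> bool" where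
  "one_form A \<omega> \<longleftrightarrow>
     (\<forall>c\<in>A. smooth_on (img c) (\<omega> c)) \<and>
     (\<forall>c\<in>A. \<forall>d\<in>A. \<forall>p\<in>dom c \<inter> dom d. \<forall>i.
        \<omega> c (coord c p) $ i =
        (\<Sum>a\<in>UNIV. \<omega> d (coord d p) $ a * transition_partial c d i a (coord c p)))"

definition symmetric_2_tensor ::
  "('m, 'n::finite) chart set \<Rightarrow> (('m, 'n) chart \<Rightarrow> real^'n \<Rightarrow> real^'n^'n) \<Rightarrow> bool" where
  "symmetric_2_tensor A g \<longleftrightarrow>
     (\<forall>c\<in>A. smooth_on (img c) (g c)) \<and>
     (\<forall>c\<in>A. \<forall>x\<in>img c. \<forall>i j. g c x $ i $ j = g c x $ j $ i) \<and>
     (\<forall>c\<in>A. \<forall>d\<in>A. \<forall>p\<in>dom c \<inter> dom d. \<forall>i j.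
        g c (coord c p) $ i $ j =
        (\<Sum>a\<in>UNIV. \<Sum>b\<in>UNIV. g d (coord d p) $ a $ b *
           transition_partial c d i a (coord c p) * transition_partial c d j b (coord c p)))"

text \<open>\<open>\<Gamma> c x $ i $ j $ k\<close> is the connection coefficient $\Gamma_{ij}{}^k$ in the chart \<open>c\<close>, so
  that $\nabla_{\partial_i}\partial_j = \Gamma_{ij}{}^k\partial_k$; torsion is allowed.\<close>

definition affine_connection ::
  "('m, 'n::finite) chart set \<Rightarrow> (('m, 'n) chart \<Rightarrow> real^'n \<Rightarrow> real^'n^'n^'n) \<Rightarrow> bool" where
  "affine_connection A \<Gamma> \<longleftrightarrow>
     (\<forall>c\<in>A. smooth_on (img c) (\<Gamma> c)) \<and>
     (\<forall>c\<in>A. \<forall>d\<in>A. \<forall>p\<in>dom c \<inter> dom d. \<forall>i j a.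
        (\<Sum>k\<in>UNIV. \<Gamma> c (coord c p) $ i $ j $ k * transition_partial c d k a (coord c p)) =
        (\<Sum>r\<in>UNIV. \<Sum>s\<in>UNIV. \<Gamma> d (coord d p) $ r $ s $ a *
           transition_partial c d i r (coord c p) * transition_partial c d j s (coord c p))
        + partial i (transition_partial c d j a) (coord c p))"

definition closed_one_form ::
  "('m, 'n::finite) chart set \<Rightarrow> (('m, 'n) chart \<Rightarrow> real^'n \<Rightarrow> real^'n) \<Rightarrow> bool" where
  "closed_one_form A \<omega> \<longleftrightarrow> one_form A \<omega> \<and>
     (\<forall>c\<in>A. \<forall>x\<in>img c. \<forall>i j.
        partial i (\<lambda>z. \<omega> c z $ j) x = partial j (\<lambda>z. \<omega> c z $ i) x)"


section \<open>Kropina metrics\<close>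

definition kropina_data ::
  "('m, 'n::finite) chart set \<Rightarrow> (('m, 'n) chart \<Rightarrow> real^'n \<Rightarrow> real^'n^'n) \<Rightarrow>
   (('m, 'n) chart \<Rightarrow> real^'n \<Rightarrow> real^'n) \<Rightarrow> bool" where
  "kropina_data A g \<omega> \<longleftrightarrow>
     symmetric_2_tensor A g \<and> one_form A \<omega> \<and>
     (\<forall>c\<in>A. \<forall>x\<in>img c. \<omega> c x \<noteq> 0) \<and>
     (\<forall>c\<in>A. \<forall>x\<in>img c. \<forall>v. \<omega> c x \<bullet> v = 0 \<and>
        (\<forall>w. \<omega> c x \<bullet> w = 0 \<longrightarrow> v \<bullet> (g c x *v w) = 0) \<longrightarrow> v = 0)"

text \<open>The metric in the chart \<open>c\<close>; only its values at \<open>\<xi>\<close> with \<open>\<omega> c x \<bullet> \<xi> \<noteq> 0\<close> matter.\<close>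

definition kropina ::
  "(('m, 'n::finite) chart \<Rightarrow> real^'n \<Rightarrow> real^'n^'n) \<Rightarrow> (('m, 'n) chart \<Rightarrow> real^'n \<Rightarrow> real^'n) \<Rightarrow>
   ('m, 'n) chart \<Rightarrow> real^'n \<Rightarrow> real^'n \<Rightarrow> real" where
  "kropina g \<omega> c x \<xi> = (\<xi> \<bullet> (g c x *v \<xi>)) / (\<omega> c x \<bullet> \<xi>)"


section \<open>Curves and geodesics\<close>

definition open_interval :: "real set \<Rightarrow> bool" where
  "open_interval I \<longleftrightarrow> open I \<and> is_interval I \<and> I \<noteq> {}"

abbreviation velocity :: "(real \<Rightarrow> real^'n::finite) \<Rightarrow> real \<Rightarrow> real^'n" where
  "velocity x t \<equiv> vector_derivative x (at t)"

definition smooth_regular_curve ::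
  "('m::topological_space, 'n::finite) chart set \<Rightarrow> real set \<Rightarrow> (real \<Rightarrow> 'm) \<Rightarrow> bool" where
  "smooth_regular_curve A I \<gamma> \<longleftrightarrow>
     open_interval I \<and> continuous_on I \<gamma> \<and>
     (\<forall>c\<in>A. smooth_on {t\<in>I. \<gamma> t \<in> dom c} (coord c \<circ> \<gamma>)) \<and>
     (\<forall>c\<in>A. \<forall>t\<in>I. \<gamma> t \<in> dom c \<longrightarrow> velocity (coord c \<circ> \<gamma>) t \<noteq> 0)"

text \<open>The Euler-Lagrange equation
  $\frac{d}{dt}\frac{\partial L}{\partial\xi^i}(x,\dot x) = \frac{\partial L}{\partial x^i}(x,\dot x)$
  at time \<open>t\<close>.\<close>

definition euler_lagrange_at ::
  "(real^'n::finite \<Rightarrow> real^'n \<Rightarrow> real) \<Rightarrow> (real \<Rightarrow> real^'n) \<Rightarrow> real \<Rightarrow> bool" where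
  "euler_lagrange_at L x t \<longleftrightarrow>
     (\<forall>i. ((\<lambda>s. partial i (L (x s)) (velocity x s)) has_real_derivative
            partial i (\<lambda>z. L z (velocity x t)) (x t)) (at t))"

definition kropina_geodesic ::
  "('m::topological_space, 'n::finite) chart set \<Rightarrow> (('m, 'n) chart \<Rightarrow> real^'n \<Rightarrow> real^'n^'n) \<Rightarrow>
   (('m, 'n) chart \<Rightarrow> real^'n \<Rightarrow> real^'n) \<Rightarrow> real set \<Rightarrow> (real \<Rightarrow> 'm) \<Rightarrow> bool" where
  "kropina_geodesic A g \<omega> I \<gamma> \<longleftrightarrow>
     smooth_regular_curve A I \<gamma> \<and>
     (\<forall>c\<in>A. \<forall>t\<in>I. \<gamma> t \<in> dom c \<longrightarrow>
        \<omega> c (coord c (\<gamma> t)) \<bullet> velocity (coord c \<circ> \<gamma>) t \<noteq> 0 \<and>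
        euler_lagrange_at (kropina g \<omega> c) (coord c \<circ> \<gamma>) t)"

definition parameterized_geodesic ::
  "('m::topological_space, 'n::finite) chart set \<Rightarrow>
   (('m, 'n) chart \<Rightarrow> real^'n \<Rightarrow> real^'n^'n^'n) \<Rightarrow> real set \<Rightarrow> (real \<Rightarrow> 'm) \<Rightarrow> bool" where
  "parameterized_geodesic A \<Gamma> I \<gamma> \<longleftrightarrow>
     smooth_regular_curve A I \<gamma> \<and>
     (\<forall>c\<in>A. \<forall>t\<in>I. \<gamma> t \<in> dom c \<longrightarrow> (let x = coord c \<circ> \<gamma>; v = velocity x t in
        \<forall>k. vector_derivative (velocity x) (at t) $ k
             + (\<Sum>i\<in>UNIV. \<Sum>j\<in>UNIV. \<Gamma> c (x t) $ i $ j $ k * v $ i * v $ j) = 0))"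

text \<open>A geodesic of a connection without preferred parameterization: a curve which becomes a
  solution of $\nabla_{\dot\gamma}\dot\gamma = 0$ after a change of parameter.  Geodesics of a
  Kropina metric need no such step, as \<open>kropina g \<omega> c x\<close> is homogeneous of degree one.\<close>

definition unparameterized_geodesic ::
  "('m::topological_space, 'n::finite) chart set \<Rightarrow>
   (('m, 'n) chart \<Rightarrow> real^'n \<Rightarrow> real^'n^'n^'n) \<Rightarrow> real set \<Rightarrow> (real \<Rightarrow> 'm) \<Rightarrow> bool" where
  "unparameterized_geodesic A \<Gamma> I \<gamma> \<longleftrightarrow>
     smooth_regular_curve A I \<gamma> \<and>
     (\<exists>J r. open_interval J \<and> bij_betw r J I \<and> smooth_on J r \<and>
        (\<forall>s\<in>J. vector_derivative r (at s) \<noteq> 0) \<and>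
        parameterized_geodesic A \<Gamma> J (\<gamma> \<circ> r))"

end

theory Submission
  imports Defs
begin

text \<open>
  If \<open>\<omega>\<close> is closed, then \<open>g + 2 \<omega> ds\<close> is a nondegenerate metric on \<open>M \<times> \<real>\<close>, and its Levi-Civita
  connection projects to \<open>M\<close>.  In a chart the projection is the unique \<open>\<nabla>\<close> with
  \<open>\<omega> \<bullet> \<nabla>(u, v) = D\<omega>(u) \<bullet> v\<close> and \<open>g(\<nabla>(u, v), k)\<close> equal to the Christoffel symbol of the first kind
  \<open>[uv, k]\<close> for all \<open>k\<close> in the kernel of \<open>\<omega>\<close>: existence and uniqueness hold because \<open>g\<close> is
  nondegenerate on that kernel, smoothness follows from Cramer's rule, and the transformation law
  from uniqueness.  Contracting the Euler-Lagrange equation of \<open>g / \<omega>\<close> with the same \<open>k\<close> gives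
  \<open>x'' + \<nabla>(x', x') = (W' / W) x'\<close> with \<open>W = \<omega>(x')\<close>, so that the parameter in which
  \<open>\<omega>(x') = 1\<close> is affine.
\<close>

section \<open>Maps of class $C^k$\<close>

text \<open>Where the product metric comes from: a curve (\<gamma>, s) with \<omega>(\<gamma>')
  \<noteq> 0 is null for it iff s' = - F(\<gamma>') / 2, so that, as in Fermat's principle, its null
  geodesics lie over the extremals of F. The vertical field V = d/ds is null, its metric dual is
  \<omega>, and no coefficient depends on s; since \<omega> is closed, V is parallel, and the
  connection descends. The two defining conditions are the pairings with V and with kernel vectors.
  The first makes \<omega> parallel; the second is restricted to the kernel because against any
  other k the s-component of the connection, unknown on M, would enter with the factor \<omega>(k).
  The product is motivation only: all arguments take place on M. Tensors and connections are given
  by components, while these conditions are free of coordinates; identities are therefore proved for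
  vector arguments, by testing against \<omega> and its kernel, and become index sums only at the
  end.\<close>

lemma Ck_on_cong:
  assumes "open S" "Ck_on k S f" "\<And>x. x \<in> S \<Longrightarrow> f x = h x"
  shows "Ck_on k S h"
  using assms(2,3)
proof (induction k arbitrary: f h)
  case 0
  then show ?case by (metis Ck_on.simps(1) continuous_on_cong)
next
  case (Suc k)
  have diff: "f differentiable (at x)" if "x \<in> S" for x
    using Suc.prems that by simp
  have eq: "frechet_derivative f (at x) = frechet_derivative h (at x)" if "x \<in> S" for x
    using frechet_derivative_transform_within_open diff \<open>open S\<close> that Suc.prems(2) by metis
  have "h differentiable (at x)" if "x \<in> S" for x
    using diff[OF that] \<open>open S\<close> that Suc.prems(2)
    unfolding differentiable_def by (metis has_derivative_transform_within_open)
  moreover have "Ck_on k S (\<lambda>x. frechet_derivative h (at x) v)" for v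
    using Suc.IH[of "\<lambda>x. frechet_derivative f (at x) v"] Suc.prems eq by simp
  ultimately show ?case by simp
qed

text \<open>Allows an explicit formula \<open>f'\<close> in place of the derivative picked by
  \<open>frechet_derivative\<close>. Most closure lemmas that follow are thus a differentiation rule
  combined with the induction hypothesis.\<close>

lemma Ck_on_SucI:
  assumes "open S" "\<And>x. x \<in> S \<Longrightarrow> (f has_derivative f' x) (at x)"
    and "\<And>v. Ck_on k S (\<lambda>x. f' x v)"
  shows "Ck_on (Suc k) S f"
proof -
  have "Ck_on k S (\<lambda>x. frechet_derivative f (at x) v)" for v
    by (rule Ck_on_cong[OF assms(1) assms(3)[of v]]) (use assms(2) frechet_derivative_at in metis)
  then show ?thesis using assms(2) by (auto simp: differentiable_def)
qed

lemma Ck_on_Suc_has_derivative: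
  assumes "Ck_on (Suc k) S f" "x \<in> S"
  shows "(f has_derivative frechet_derivative f (at x)) (at x)"
  using assms by (simp add: frechet_derivative_works)

lemma Ck_on_Suc_imp_Ck_on: "Ck_on (Suc k) S f \<Longrightarrow> Ck_on k S f"
proof (induction k arbitrary: f)
  case 0
  then show ?case
    by (auto intro!: continuous_at_imp_continuous_on differentiable_imp_continuous_within)
next
  case (Suc k)
  then show ?case
    unfolding Ck_on.simps(2)[of "Suc k"] Ck_on.simps(2)[of k S f] by blast
qed

lemma Ck_on_subset: "Ck_on k S f \<Longrightarrow> T \<subseteq> S \<Longrightarrow> Ck_on k T f"
proof (induction k arbitrary: f)
  case 0
  then show ?case by (auto intro: continuous_on_subset)
next
  case (Suc k)
  then show ?case unfolding Ck_on.simps(2) by blast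
qed

text \<open>Regularity is a local property. This serves functions that have a smooth expression only
  near each point, such as \<omega>(\<gamma>') along a curve that leaves a chart.\<close>

lemma Ck_on_local:
  assumes "\<And>x. x \<in> S \<Longrightarrow> \<exists>U. open U \<and> x \<in> U \<and> Ck_on k U f"
  shows "Ck_on k S f"
  using assms
proof (induction k arbitrary: f)
  case 0
  have "isCont f x" if x: "x \<in> S" for x
  proof -
    obtain U where "open U" "x \<in> U" "Ck_on 0 U f" using 0[OF x] by blast
    then show ?thesis by (simp add: continuous_on_eq_continuous_at)
  qed
  then show ?case by (simp add: continuous_at_imp_continuous_on)
next
  case (Suc k)
  have "f differentiable (at x)" if x: "x \<in> S" for x
  proof -
    obtain U where "x \<in> U" "Ck_on (Suc k) U f" using Suc.prems[OF x] by blast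
    then show ?thesis by simp
  qed
  moreover have "Ck_on k S (\<lambda>x. frechet_derivative f (at x) v)" for v
  proof (rule Suc.IH)
    fix x assume "x \<in> S"
    then obtain U where "open U" "x \<in> U" "Ck_on (Suc k) U f" using Suc.prems by blast
    then show "\<exists>U. open U \<and> x \<in> U \<and> Ck_on k U (\<lambda>x. frechet_derivative f (at x) v)"
      by (intro exI[of _ U]) simp
  qed
  ultimately show ?case by simp
qed

lemma Ck_on_const: "open S \<Longrightarrow> Ck_on k S (\<lambda>x. c)"
proof (induction k arbitrary: c)
  case (Suc k)
  then show ?case by (intro Ck_on_SucI[where f' = "\<lambda>x v. 0"]) auto
qed simp

lemma Ck_on_bounded_linear:
  assumes "open S" "bounded_linear h" "Ck_on k S f"
  shows "Ck_on k S (\<lambda>x. h (f x))"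
  using assms(3)
proof (induction k arbitrary: f)
  case 0
  then show ?case
    using assms(2) by (simp add: bounded_linear.continuous_on)
next
  case (Suc k)
  have "Ck_on k S (\<lambda>x. frechet_derivative f (at x) v)" for v
    using Suc.prems by simp
  note IH = Suc.IH[OF this]
  show ?case
    by (rule Ck_on_SucI[OF assms(1) bounded_linear.has_derivative[OF assms(2)
        Ck_on_Suc_has_derivative[OF Suc.prems]] IH])
qed

lemma Ck_on_add:
  assumes "open S" "Ck_on k S f" "Ck_on k S h"
  shows "Ck_on k S (\<lambda>x. f x + h x)"
  using assms(2,3)
proof (induction k arbitrary: f h)
  case 0
  then show ?case by (simp add: continuous_on_add)
next
  case (Suc k)
  have "Ck_on k S (\<lambda>x. frechet_derivative f (at x) v)"
    and "Ck_on k S (\<lambda>x. frechet_derivative h (at x) v)" for v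
    using Suc.prems by simp_all
  note IH = Suc.IH[OF this]
  show ?case
    by (rule Ck_on_SucI[OF assms(1) has_derivative_add[OF
        Ck_on_Suc_has_derivative[OF Suc.prems(1)] Ck_on_Suc_has_derivative[OF Suc.prems(2)]] IH])
qed

text \<open>The product rule gives two terms, each with one factor differentiated; hence the
  induction over all pairs \<open>f\<close>, \<open>h\<close>, with the other factor lowered by one
  order. Products, scalar multiples and inner products are instances.\<close>

lemma Ck_on_bounded_bilinear:
  assumes "open S" "bounded_bilinear b" "Ck_on k S f" "Ck_on k S h"
  shows "Ck_on k S (\<lambda>x. b (f x) (h x))"
  using assms(3,4)
proof (induction k arbitrary: f h)
  case 0
  then show ?case using bounded_bilinear.continuous_on[OF assms(2)] by auto
next
  case (Suc k)
  note prems = Suc.prems[THEN Ck_on_Suc_imp_Ck_on]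
  have f: "Ck_on k S (\<lambda>x. frechet_derivative f (at x) v)"
    and h: "Ck_on k S (\<lambda>x. frechet_derivative h (at x) v)" for v
    using Suc.prems by simp_all
  show ?case
    by (rule Ck_on_SucI[OF assms(1) bounded_bilinear.FDERIV[OF assms(2)
        Ck_on_Suc_has_derivative[OF Suc.prems(1)] Ck_on_Suc_has_derivative[OF Suc.prems(2)]]
        Ck_on_add[OF assms(1) Suc.IH[OF prems(1) h] Suc.IH[OF f prems(2)]]])
qed

lemmas Ck_on_mult = Ck_on_bounded_bilinear[OF _ bounded_bilinear_mult]
lemmas Ck_on_scaleR = Ck_on_bounded_bilinear[OF _ bounded_bilinear_scaleR]
lemmas Ck_on_inner = Ck_on_bounded_bilinear[OF _ bounded_bilinear_inner]

lemma Ck_on_minus: "open S \<Longrightarrow> Ck_on k S f \<Longrightarrow> Ck_on k S (\<lambda>x. - f x)"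
  by (rule Ck_on_bounded_linear[OF _ bounded_linear_minus[OF bounded_linear_ident]])

lemma Ck_on_diff:
  "open S \<Longrightarrow> Ck_on k S f \<Longrightarrow> Ck_on k S h \<Longrightarrow> Ck_on k S (\<lambda>x. f x - h x)"
  using Ck_on_add[of S k f "\<lambda>x. - h x"] Ck_on_minus[of S k h] by simp

lemma Ck_on_sum:
  "open S \<Longrightarrow> (\<And>i. i \<in> B \<Longrightarrow> Ck_on k S (f i)) \<Longrightarrow> Ck_on k S (\<lambda>x. \<Sum>i\<in>B. f i x)"
  by (induction B rule: infinite_finite_induct) (auto intro!: Ck_on_add Ck_on_const)

lemma Ck_on_prod:
  fixes f :: "'i \<Rightarrow> 'a::euclidean_space \<Rightarrow> real"
  shows "open S \<Longrightarrow> (\<And>i. i \<in> B \<Longrightarrow> Ck_on k S (f i)) \<Longrightarrow> Ck_on k S (\<lambda>x. \<Prod>i\<in>B. f i x)"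
  by (induction B rule: infinite_finite_induct) (auto intro!: Ck_on_mult Ck_on_const)

text \<open>The derivative -(1/f) f' (1/f) contains 1/f again, so the induction hypothesis for the
  same \<open>f\<close> closes the argument.\<close>

lemma Ck_on_inverse:
  fixes f :: "'a::euclidean_space \<Rightarrow> real"
  assumes "open S" "Ck_on k S f" "\<And>x. x \<in> S \<Longrightarrow> f x \<noteq> 0"
  shows "Ck_on k S (\<lambda>x. inverse (f x))"
  using assms(2)
proof (induction k)
  case 0
  then show ?case using assms(3) by (auto intro: continuous_intros)
next
  case (Suc k)
  note prems = Ck_on_Suc_imp_Ck_on[OF Suc.prems]
  note IH = Suc.IH[OF prems]
  have f: "Ck_on k S (\<lambda>x. frechet_derivative f (at x) v)" for v
    using Suc.prems by simp
  show ?case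
    by (rule Ck_on_SucI[OF assms(1) Deriv.has_derivative_inverse[OF assms(3)
        Ck_on_Suc_has_derivative[OF Suc.prems]]
        Ck_on_minus[OF assms(1) Ck_on_mult[OF assms(1) Ck_on_mult[OF assms(1) IH f] IH]]])
qed

lemma Ck_on_divide:
  fixes f h :: "'a::euclidean_space \<Rightarrow> real"
  shows "open S \<Longrightarrow> Ck_on k S f \<Longrightarrow> Ck_on k S h \<Longrightarrow> (\<And>x. x \<in> S \<Longrightarrow> h x \<noteq> 0) \<Longrightarrow>
    Ck_on k S (\<lambda>x. f x / h x)"
  unfolding divide_inverse by (intro Ck_on_mult Ck_on_inverse)

text \<open>The chain rule applies the derivative of \<open>h\<close> to a direction that varies
  with \<open>x\<close>, while \<open>Ck_on\<close> speaks of fixed directions. Expanding the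
  direction in the basis leaves derivatives of \<open>h\<close> in basis directions, composed with
  \<open>f\<close>, to which the induction hypothesis applies.\<close>

lemma Ck_on_compose:
  fixes f :: "'a::euclidean_space \<Rightarrow> 'b::euclidean_space"
  assumes "open S" "Ck_on k S f" "Ck_on k T h" "f ` S \<subseteq> T"
  shows "Ck_on k S (\<lambda>x. h (f x))"
  using assms(2,3)
proof (induction k arbitrary: h)
  case 0
  then show ?case
    using assms(4) continuous_on_compose2 by auto
next
  case (Suc k)
  have der: "((\<lambda>x. h (f x)) has_derivative
      (\<lambda>v. \<Sum>b\<in>Basis. (frechet_derivative f (at x) v \<bullet> b) *\<^sub>R frechet_derivative h (at (f x)) b)) (at x)"
    if x: "x \<in> S" for x
  proof -
    have fx: "f x \<in> T" using x assms(4) by auto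
    note d = Ck_on_Suc_has_derivative[OF Suc.prems(2) fx]
    have "((\<lambda>x. h (f x)) has_derivative
        (\<lambda>v. frechet_derivative h (at (f x)) (frechet_derivative f (at x) v))) (at x)"
      using diff_chain_at[OF Ck_on_Suc_has_derivative[OF Suc.prems(1) x] d] by (simp add: o_def)
    moreover have "frechet_derivative h (at (f x)) w =
        (\<Sum>b\<in>Basis. (w \<bullet> b) *\<^sub>R frechet_derivative h (at (f x)) b)" for w
      using linear_sum[OF has_derivative_linear[OF d], of "\<lambda>b. (w \<bullet> b) *\<^sub>R b" Basis]
        linear_cmul[OF has_derivative_linear[OF d]] by (simp add: euclidean_representation)
    ultimately show ?thesis by (rule has_derivative_eq_rhs[OF _ ext])
  qed
  have f: "Ck_on k S (\<lambda>x. frechet_derivative f (at x) v)" for v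
    using Suc.prems(1) by simp
  have h: "Ck_on k S (\<lambda>x. frechet_derivative h (at (f x)) b)" for b
    using Suc.IH[OF Ck_on_Suc_imp_Ck_on[OF Suc.prems(1)], of "\<lambda>y. frechet_derivative h (at y) b"]
      Suc.prems(2) unfolding Ck_on.simps(2) by blast
  show ?case
    by (rule Ck_on_SucI[OF assms(1) der], assumption)
      (rule Ck_on_sum[OF assms(1) Ck_on_scaleR[OF assms(1)
        Ck_on_inner[OF assms(1) f Ck_on_const[OF assms(1)]] h]])
qed

lemma Ck_on_vec:
  fixes f :: "'a::euclidean_space \<Rightarrow> 'b::real_normed_vector ^ 'n::finite"
  assumes "open S" "\<And>i. Ck_on k S (\<lambda>x. f x $ i)"
  shows "Ck_on k S f"
proof -
  have bl: "bounded_linear (axis i :: 'b \<Rightarrow> 'b ^ 'n)" for i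
  proof (rule bounded_linear_intro[where K = 1])
    fix x y :: 'b and r :: real
    show "axis i (x + y) = axis i x + axis i y" "axis i (r *\<^sub>R x) = r *\<^sub>R axis i x"
      by (auto simp: vec_eq_iff axis_def)
    have "norm (axis i x) \<le> (\<Sum>j\<in>UNIV. norm (axis i x $ j))"
      by (simp add: norm_vec_def L2_set_le_sum)
    also have "\<dots> = (\<Sum>j\<in>UNIV. if j = i then norm x else 0)"
      by (rule sum.cong) (auto simp: axis_def)
    finally show "norm (axis i x) \<le> norm x * 1" by simp
  qed
  have "Ck_on k S (\<lambda>x. \<Sum>i\<in>UNIV. axis i (f x $ i))"
    by (intro Ck_on_sum Ck_on_bounded_linear[OF _ bl] assms)
  moreover have "(\<Sum>i\<in>UNIV. axis i (f x $ i)) = f x" for x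
    by (simp add: vec_eq_iff axis_def)
  ultimately show ?thesis by simp
qed

lemma Ck_on_vec_nth: "open S \<Longrightarrow> Ck_on k S f \<Longrightarrow> Ck_on k S (\<lambda>x. f x $ i)"
  by (rule Ck_on_bounded_linear[OF _ bounded_linear_vec_nth])

lemma Ck_on_det:
  fixes f :: "'a::euclidean_space \<Rightarrow> real ^ 'n::finite ^ 'n"
  shows "open S \<Longrightarrow> (\<And>i j. Ck_on k S (\<lambda>x. f x $ i $ j)) \<Longrightarrow> Ck_on k S (\<lambda>x. det (f x))"
  unfolding det_def by (intro Ck_on_sum Ck_on_mult Ck_on_prod Ck_on_const)

text \<open>On the line every directional derivative is a multiple of the vector derivative, so
  velocities inherit smoothness from their curves.\<close>

lemma Ck_on_real_Suc_iff:
  fixes f :: "real \<Rightarrow> 'b::real_normed_vector"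
  assumes "open S"
  shows "Ck_on (Suc k) S f \<longleftrightarrow>
    (\<forall>t\<in>S. f differentiable (at t)) \<and> Ck_on k S (\<lambda>t. vector_derivative f (at t))" (is "_ = ?R")
proof
  assume *: "Ck_on (Suc k) S f"
  then have "Ck_on k S (\<lambda>t. frechet_derivative f (at t) 1)" by simp
  then have "Ck_on k S (\<lambda>t. vector_derivative f (at t))"
    by (rule Ck_on_cong[OF assms]) (use * in \<open>simp add: frechet_derivative_eq_vector_derivative\<close>)
  with * show ?R by simp
next
  assume *: ?R
  have "Ck_on k S (\<lambda>t. frechet_derivative f (at t) v)" for v
    by (rule Ck_on_cong[OF assms Ck_on_scaleR[OF assms Ck_on_const[OF assms], of k "vector_derivative f o at" v]])
      (use * in \<open>auto simp: frechet_derivative_eq_vector_derivative o_def\<close>)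
  with * show "Ck_on (Suc k) S f" by simp
qed

section \<open>Smooth maps and their derivatives\<close>

lemma smooth_on_Suc_iff:
  "smooth_on S f \<longleftrightarrow>
    (\<forall>x\<in>S. f differentiable (at x)) \<and> (\<forall>v. smooth_on S (\<lambda>x. frechet_derivative f (at x) v))"
proof -
  have "smooth_on S f \<longleftrightarrow> (\<forall>k. Ck_on (Suc k) S f)"
    unfolding smooth_on_def using Ck_on_Suc_imp_Ck_on by blast
  then show ?thesis unfolding smooth_on_def Ck_on.simps(2) by blast
qed

lemma smooth_on_has_derivative:
  "smooth_on S f \<Longrightarrow> x \<in> S \<Longrightarrow> (f has_derivative frechet_derivative f (at x)) (at x)"
  by (metis smooth_on_Suc_iff frechet_derivative_works)

lemma smooth_on_frechet_derivative:
  "smooth_on S f \<Longrightarrow> smooth_on S (\<lambda>x. frechet_derivative f (at x) v)"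
  by (metis smooth_on_Suc_iff)

lemma smooth_on_imp_continuous_on: "smooth_on S f \<Longrightarrow> continuous_on S f"
  unfolding smooth_on_def by (metis Ck_on.simps(1))

section \<open>Symmetry of second derivatives\<close>

text \<open>Mean value theorem twice: in direction \<open>u\<close> for the difference f(z + h v) -
  f(z), then in direction \<open>v\<close> for the derivative of \<open>f\<close> along
  \<open>u\<close>. The second difference is symmetric in \<open>u\<close> and \<open>v\<close>,
  which is what forces the mixed derivatives to agree.\<close>

lemma second_difference_mvt:
  fixes f :: "'a::euclidean_space \<Rightarrow> real"
  assumes f: "smooth_on S f" and h: "0 < h"
    and S: "\<And>s t. 0 \<le> s \<Longrightarrow> s \<le> h \<Longrightarrow> 0 \<le> t \<Longrightarrow> t \<le> h \<Longrightarrow> x + s *\<^sub>R u + t *\<^sub>R v \<in> S"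
  shows "\<exists>s t. 0 < s \<and> s < h \<and> 0 < t \<and> t < h \<and>
    f (x + h *\<^sub>R u + h *\<^sub>R v) - f (x + h *\<^sub>R u) - f (x + h *\<^sub>R v) + f x =
    h * h * frechet_derivative (\<lambda>z. frechet_derivative f (at z) u) (at (x + s *\<^sub>R u + t *\<^sub>R v)) v"
proof -
  define fu where "fu = (\<lambda>z. frechet_derivative f (at z) u)"
  have fu: "smooth_on S fu" unfolding fu_def by (rule smooth_on_frechet_derivative[OF f])
  have line: "((\<lambda>s. \<phi> (z + s *\<^sub>R w)) has_real_derivative frechet_derivative \<phi> (at (z + s *\<^sub>R w)) w) (at s)"
    if "smooth_on S \<phi>" "z + s *\<^sub>R w \<in> S" for \<phi> :: "'a \<Rightarrow> real" and z w s
  proof -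
    note d = smooth_on_has_derivative[OF that]
    have "((\<lambda>s. z + s *\<^sub>R w) has_derivative (\<lambda>s. s *\<^sub>R w)) (at s)"
      by (auto intro!: derivative_eq_intros)
    from diff_chain_at[OF this d]
    have "((\<lambda>s. \<phi> (z + s *\<^sub>R w)) has_derivative (\<lambda>r. frechet_derivative \<phi> (at (z + s *\<^sub>R w)) (r *\<^sub>R w))) (at s)"
      by (simp add: o_def)
    then show ?thesis unfolding has_field_derivative_def
      by (rule has_derivative_eq_rhs) (simp add: fun_eq_iff linear_cmul[OF has_derivative_linear[OF d]])
  qed
  have "\<exists>s. 0 < s \<and> s < h \<and>
      (f ((x + h *\<^sub>R v) + h *\<^sub>R u) - f (x + h *\<^sub>R u)) - (f ((x + h *\<^sub>R v) + 0 *\<^sub>R u) - f (x + 0 *\<^sub>R u)) =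
      (h - 0) * (fu ((x + h *\<^sub>R v) + s *\<^sub>R u) - fu (x + s *\<^sub>R u))"
  proof (rule MVT2[OF h])
    fix s assume s: "0 \<le> s" "s \<le> h"
    have "(x + h *\<^sub>R v) + s *\<^sub>R u \<in> S" "x + s *\<^sub>R u \<in> S"
      using S[OF s, of h] S[OF s, of 0] h by (auto simp: algebra_simps)
    from this[THEN line[OF f]]
    show "((\<lambda>s. f ((x + h *\<^sub>R v) + s *\<^sub>R u) - f (x + s *\<^sub>R u)) has_real_derivative
        fu ((x + h *\<^sub>R v) + s *\<^sub>R u) - fu (x + s *\<^sub>R u)) (at s)"
      unfolding fu_def by (rule DERIV_diff)
  qed
  then obtain s where s: "0 < s" "s < h" and eq1:
    "f (x + h *\<^sub>R u + h *\<^sub>R v) - f (x + h *\<^sub>R u) - f (x + h *\<^sub>R v) + f x =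
      h * (fu (x + s *\<^sub>R u + h *\<^sub>R v) - fu (x + s *\<^sub>R u))"
    by (auto simp: algebra_simps)
  have "\<exists>t. 0 < t \<and> t < h \<and> fu (x + s *\<^sub>R u + h *\<^sub>R v) - fu (x + s *\<^sub>R u + 0 *\<^sub>R v) =
      (h - 0) * frechet_derivative fu (at (x + s *\<^sub>R u + t *\<^sub>R v)) v"
    by (rule MVT2[OF h]) (use line[OF fu] S s in auto)
  with s eq1 show ?thesis by (auto simp: fu_def)
qed

text \<open>If the mixed derivatives differ at \<open>x\<close>, continuity keeps each within half
  of the gap on a small ball, so they cannot take a common value there; yet the common second
  difference makes them equal at two points of the ball.\<close>

theorem frechet_derivative_symmetric:
  fixes f :: "'a::euclidean_space \<Rightarrow> real"
  assumes f: "smooth_on S f" and "open S" "x \<in> S"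
  shows "frechet_derivative (\<lambda>z. frechet_derivative f (at z) u) (at x) v =
    frechet_derivative (\<lambda>z. frechet_derivative f (at z) v) (at x) u"
proof (rule ccontr)
  define D where "D = (\<lambda>u v z. frechet_derivative (\<lambda>z. frechet_derivative f (at z) u) (at z) v)"
  assume "\<not> ?thesis"
  then have e: "0 < \<bar>D u v x - D v u x\<bar> / 2" (is "0 < ?e") by (simp add: D_def)
  have "continuous_on S (D u v)" for u v
    unfolding D_def by (intro smooth_on_imp_continuous_on smooth_on_frechet_derivative f)
  then have c: "isCont (D u v) x" for u v
    using assms by (simp add: continuous_on_eq_continuous_at)
  obtain d1 where d1: "d1 > 0" "ball x d1 \<subseteq> S"
    using assms by (meson open_contains_ball)
  obtain d2 where d2: "d2 > 0" "\<And>z. dist z x < d2 \<Longrightarrow> \<bar>D u v z - D u v x\<bar> < ?e"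
    using c[of u v] e unfolding continuous_at_eps_delta dist_real_def by metis
  obtain d3 where d3: "d3 > 0" "\<And>z. dist z x < d3 \<Longrightarrow> \<bar>D v u z - D v u x\<bar> < ?e"
    using c[of v u] e unfolding continuous_at_eps_delta dist_real_def by metis
  define d where "d = min d1 (min d2 d3)"
  have d: "d > 0" using d1 d2 d3 by (simp add: d_def)
  \<comment> \<open>With this side length the whole parallelogram spanned by h u and h v stays
    within distance \<open>d\<close> of \<open>x\<close>; the summand 1 keeps the denominator
    positive when both vectors vanish.\<close>
  define h where "h = d / (norm u + norm v + 1)"
  have nz: "norm u + norm v + 1 > 0"
    by (smt (verit) norm_ge_zero)
  have h: "h > 0" using d nz by (simp add: h_def)
  have near: "norm (s *\<^sub>R u + t *\<^sub>R v) < d" if "0 \<le> s" "s \<le> h" "0 \<le> t" "t \<le> h" for s t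
  proof -
    have "norm (s *\<^sub>R u + t *\<^sub>R v) \<le> s * norm u + t * norm v"
      using norm_triangle_ineq[of "s *\<^sub>R u" "t *\<^sub>R v"] that by simp
    also have "\<dots> \<le> h * norm u + h * norm v"
      using that by (intro add_mono mult_right_mono) auto
    also have "\<dots> < h * (norm u + norm v + 1)" using h by (simp add: algebra_simps)
    finally show ?thesis using nz by (simp add: h_def)
  qed
  have S1: "x + s *\<^sub>R u + t *\<^sub>R v \<in> S" if "0 \<le> s" "s \<le> h" "0 \<le> t" "t \<le> h" for s t
    using near[OF that] d1 by (auto simp: d_def dist_norm subset_iff norm_minus_commute algebra_simps)
  then have S2: "x + s *\<^sub>R v + t *\<^sub>R u \<in> S" if "0 \<le> s" "s \<le> h" "0 \<le> t" "t \<le> h" for s t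
    using that by (metis add.commute add.assoc)
  have "\<exists>s t. 0 < s \<and> s < h \<and> 0 < t \<and> t < h \<and>
    f (x + h *\<^sub>R u + h *\<^sub>R v) - f (x + h *\<^sub>R u) - f (x + h *\<^sub>R v) + f x =
      h * h * D u v (x + s *\<^sub>R u + t *\<^sub>R v)"
    unfolding D_def by (rule second_difference_mvt[OF f h S1])
  then obtain s t where st: "0 < s" "s < h" "0 < t" "t < h"
    "f (x + h *\<^sub>R u + h *\<^sub>R v) - f (x + h *\<^sub>R u) - f (x + h *\<^sub>R v) + f x =
      h * h * D u v (x + s *\<^sub>R u + t *\<^sub>R v)" by blast
  have "\<exists>s t. 0 < s \<and> s < h \<and> 0 < t \<and> t < h \<and>
    f (x + h *\<^sub>R v + h *\<^sub>R u) - f (x + h *\<^sub>R v) - f (x + h *\<^sub>R u) + f x =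
      h * h * D v u (x + s *\<^sub>R v + t *\<^sub>R u)"
    unfolding D_def by (rule second_difference_mvt[OF f h S2])
  then obtain s' t' where st': "0 < s'" "s' < h" "0 < t'" "t' < h"
    "f (x + h *\<^sub>R v + h *\<^sub>R u) - f (x + h *\<^sub>R v) - f (x + h *\<^sub>R u) + f x =
      h * h * D v u (x + s' *\<^sub>R v + t' *\<^sub>R u)" by blast
  have "h * h * D u v (x + s *\<^sub>R u + t *\<^sub>R v) = h * h * D v u (x + s' *\<^sub>R v + t' *\<^sub>R u)"
    using st(5) st'(5) by (simp add: algebra_simps)
  then have "D u v (x + s *\<^sub>R u + t *\<^sub>R v) = D v u (x + s' *\<^sub>R v + t' *\<^sub>R u)"
    using h by simp
  moreover have "\<bar>D u v (x + s *\<^sub>R u + t *\<^sub>R v) - D u v x\<bar> < ?e"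
    using near[of s t] st by (intro d2(2)) (auto simp: d_def dist_norm add.assoc)
  moreover have "\<bar>D v u (x + s' *\<^sub>R v + t' *\<^sub>R u) - D v u x\<bar> < ?e"
    using near[of t' s'] st' by (intro d3(2)) (auto simp: d_def dist_norm algebra_simps)
  ultimately show False by (smt (verit) field_sum_of_halves)
qed

text \<open>The mean value argument is for real functions, so the vector case is read off from inner
  products with basis vectors. It is applied to transition maps.\<close>

lemma frechet_derivative_symmetric_euclidean:
  fixes f :: "'a::euclidean_space \<Rightarrow> 'b::euclidean_space"
  assumes f: "smooth_on S f" and S: "open S" "x \<in> S"
  shows "frechet_derivative (\<lambda>z. frechet_derivative f (at z) u) (at x) v =
    frechet_derivative (\<lambda>z. frechet_derivative f (at z) v) (at x) u"
proof (rule euclidean_eqI)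
  fix b :: 'b assume "b \<in> Basis"
  have smooth: "smooth_on S (\<lambda>z. f z \<bullet> b)"
    using f unfolding smooth_on_def
    by (auto intro: Ck_on_bounded_linear[OF S(1) bounded_linear_inner_left])
  have fd: "frechet_derivative (\<lambda>z. \<phi> z \<bullet> b) (at z) h = frechet_derivative \<phi> (at z) h \<bullet> b"
    if "smooth_on S \<phi>" "z \<in> S" for \<phi> :: "'a \<Rightarrow> 'b" and z h
    using frechet_derivative_at[OF bounded_linear.has_derivative[OF bounded_linear_inner_left
        smooth_on_has_derivative[OF that]], of b] by metis
  have "frechet_derivative (\<lambda>z. frechet_derivative (\<lambda>z. f z \<bullet> b) (at z) u) (at x) v =
      frechet_derivative (\<lambda>z. frechet_derivative f (at z) u) (at x) v \<bullet> b" for u v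
  proof -
    note d = smooth_on_frechet_derivative[OF f, of u]
    have "(\<lambda>z. frechet_derivative f (at z) u \<bullet> b) differentiable (at x)"
      using bounded_linear.has_derivative[OF bounded_linear_inner_left smooth_on_has_derivative[OF d S(2)], of b]
      by (auto simp: differentiable_def)
    then have "frechet_derivative (\<lambda>z. frechet_derivative f (at z) u \<bullet> b) (at x) =
        frechet_derivative (\<lambda>z. frechet_derivative (\<lambda>z. f z \<bullet> b) (at z) u) (at x)"
      by (rule frechet_derivative_transform_within_open[OF _ S]) (simp add: fd[OF f])
    then show ?thesis using fd[OF d S(2)] by metis
  qed
  then show "frechet_derivative (\<lambda>z. frechet_derivative f (at z) u) (at x) v \<bullet> b =
      frechet_derivative (\<lambda>z. frechet_derivative f (at z) v) (at x) u \<bullet> b"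
    using frechet_derivative_symmetric[OF smooth S] by metis
qed

section \<open>The connection in a chart\<close>

lemma bilinear_expansion_axis:
  fixes f :: "real^'n::finite \<Rightarrow> real^'m::finite \<Rightarrow> 'b::real_vector"
  assumes "\<And>v. linear (\<lambda>u. f u v)" "\<And>u. linear (f u)"
  shows "(\<Sum>i\<in>UNIV. \<Sum>j\<in>UNIV. (u $ i * v $ j) *\<^sub>R f (axis i 1) (axis j 1)) = f u v"
proof -
  have u: "(\<Sum>i\<in>UNIV. u $ i *\<^sub>R axis i 1) = u" and v: "(\<Sum>j\<in>UNIV. v $ j *\<^sub>R axis j 1) = v"
    using basis_expansion[of u] basis_expansion[of v] by (simp_all add: scalar_mult_eq_scaleR)
  have "f (axis i 1) v = (\<Sum>j\<in>UNIV. v $ j *\<^sub>R f (axis i 1) (axis j 1))" for i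
    using linear_sum[OF assms(2)[of "axis i 1"], of "\<lambda>j. v $ j *\<^sub>R axis j 1" UNIV] v
    by (simp add: linear_cmul[OF assms(2)])
  moreover have "f u v = (\<Sum>i\<in>UNIV. u $ i *\<^sub>R f (axis i 1) v)"
    using linear_sum[OF assms(1)[of v], of "\<lambda>i. u $ i *\<^sub>R axis i 1" UNIV] u
    by (simp add: linear_cmul[OF assms(1)])
  ultimately show ?thesis by (simp add: scaleR_sum_right)
qed

lemma linear_expansion_axis:
  fixes f :: "real^'n::finite \<Rightarrow> 'b::real_vector"
  assumes "linear f"
  shows "(\<Sum>i\<in>UNIV. u $ i *\<^sub>R f (axis i 1)) = f u"
proof -
  have u: "(\<Sum>i\<in>UNIV. u $ i *\<^sub>R axis i 1) = u"
    using basis_expansion[of u] by (simp add: scalar_mult_eq_scaleR)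
  show ?thesis
    using linear_sum[OF assms, of "\<lambda>i. u $ i *\<^sub>R axis i 1" UNIV] u
    by (simp add: linear_cmul[OF assms])
qed

lemma linear_matrix_vector_mult_left: "linear (\<lambda>A :: real^'n::finite^'m::finite. A *v x)"
  by (rule linearI) (simp_all add: matrix_vector_mult_add_rdistrib scaleR_matrix_vector_assoc)

lemma bounded_bilinear_matrix_vector_mult:
  "bounded_bilinear (\<lambda>(A :: real^'n::finite^'m::finite) x. A *v x)"
proof -
  have "bilinear (\<lambda>(A :: real^'n^'m) x. A *v x)"
    unfolding bilinear_def
    by (simp add: linear_matrix_vector_mult_left matrix_vector_mul_linear)
  then show ?thesis by (simp add: bilinear_conv_bounded_bilinear)
qed

lemma symmetric_matrix_inner:
  fixes G :: "real^'n::finite^'n"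
  assumes "transpose G = G"
  shows "u \<bullet> (G *v v) = v \<bullet> (G *v u)"
  by (metis assms dot_lmul_matrix inner_commute transpose_matrix_vector)

section \<open>Linear algebra of a symmetric matrix on the kernel of a covector\<close>

definition nondegenerate_on_kernel :: "real^'n::finite^'n \<Rightarrow> real^'n \<Rightarrow> bool" where
  "nondegenerate_on_kernel G w \<longleftrightarrow> w \<noteq> 0 \<and> transpose G = G \<and>
     (\<forall>v. w \<bullet> v = 0 \<and> (\<forall>u. w \<bullet> u = 0 \<longrightarrow> u \<bullet> (G *v v) = 0) \<longrightarrow> v = 0)"

text \<open>The difference of \<open>x\<close> and \<open>y\<close> lies in the kernel of
  \<open>w\<close> and is \<open>G\<close>-orthogonal to that kernel. This uniqueness principle
  yields the invertibility of the linear system, the bilinearity and the transformation law of the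
  connection, and the geodesic equation.\<close>

lemma eq_if_nondegenerate_on_kernel:
  assumes "nondegenerate_on_kernel G w" "w \<bullet> x = w \<bullet> y"
    and "\<And>u. w \<bullet> u = 0 \<Longrightarrow> u \<bullet> (G *v x) = u \<bullet> (G *v y)"
  shows "x = y"
proof -
  have "w \<bullet> (x - y) = 0" "\<forall>u. w \<bullet> u = 0 \<longrightarrow> u \<bullet> (G *v (x - y)) = 0"
    using assms(2,3) by (auto simp: inner_diff_right matrix_vector_mult_diff_distrib)
  then have "x - y = 0" using assms(1) unfolding nondegenerate_on_kernel_def by blast
  then show ?thesis by simp
qed

text \<open>The system \<open>w \<bullet> y = a\<close>, \<open>u \<bullet> (G *v y) = u \<bullet> c\<close> for all \<open>u\<close> orthogonal to \<open>w\<close>, as a single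
  square linear system: the second equation is projected along \<open>w\<close>, without division.\<close>

definition kernel_matrix :: "real^'n::finite^'n \<Rightarrow> real^'n \<Rightarrow> real^'n^'n" where
  "kernel_matrix G w =
     (\<chi> i j. (w \<bullet> w) * G $ i $ j - w $ i * (w \<bullet> column j G) + w $ i * w $ j)"

definition kernel_rhs :: "real^'n::finite \<Rightarrow> real^'n \<Rightarrow> real \<Rightarrow> real^'n" where
  "kernel_rhs w c a = (w \<bullet> w) *\<^sub>R c - (w \<bullet> c) *\<^sub>R w + a *\<^sub>R w"

definition kernel_solution :: "real^'n::finite^'n \<Rightarrow> real^'n \<Rightarrow> real^'n \<Rightarrow> real \<Rightarrow> real^'n" where
  "kernel_solution G w c a = (\<chi> k. det (\<chi> i j. if j = k then kernel_rhs w c a $ i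
     else kernel_matrix G w $ i $ j) / det (kernel_matrix G w))"

text \<open>The matrix sends \<open>y\<close> to the right-hand side built from the data of
  \<open>y\<close> itself. Solving the system thus means equating two right-hand sides, which can be
  decoded without looking into the matrix.\<close>

lemma kernel_matrix_mult:
  "kernel_matrix G w *v y = kernel_rhs w (G *v y) (w \<bullet> y)"
proof -
  have "(\<Sum>j\<in>UNIV. (w \<bullet> column j G) * y $ j) = w \<bullet> (G *v y)"
    by (simp add: inner_vec_def column_def matrix_vector_mult_def sum_distrib_right sum_distrib_left)
      (subst sum.swap, simp add: mult_ac)
  then show ?thesis
    by (simp add: vec_eq_iff kernel_matrix_def kernel_rhs_def matrix_vector_mult_def
        inner_vec_def[of w y] sum_subtractf sum.distrib ring_distribs mult.assoc
        flip: sum_distrib_left)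
qed

text \<open>Pairing \<open>kernel_rhs w c a\<close> with \<open>w\<close> cancels the two terms with
  \<open>c\<close> and leaves a (w \<bullet> w); pairing it with \<open>u\<close> orthogonal to
  \<open>w\<close> kills the multiples of \<open>w\<close> and leaves (w \<bullet> w) (u \<bullet>
  c). So one vector encodes both conditions.\<close>

lemma kernel_rhs_eqD:
  assumes "w \<noteq> 0" "kernel_rhs w c a = kernel_rhs w c' a'"
  shows "a = a'" "w \<bullet> u = 0 \<Longrightarrow> u \<bullet> c = u \<bullet> c'"
proof -
  have w: "w \<bullet> w \<noteq> 0" using assms by simp
  have "w \<bullet> kernel_rhs w c a = w \<bullet> kernel_rhs w c' a'" using assms by simp
  then show "a = a'" using w by (simp add: kernel_rhs_def inner_add_right inner_diff_right)
  assume u: "w \<bullet> u = 0"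
  have "u \<bullet> kernel_rhs w c a = u \<bullet> kernel_rhs w c' a'" using assms by simp
  then show "u \<bullet> c = u \<bullet> c'"
    using w u by (simp add: kernel_rhs_def inner_add_right inner_diff_right inner_commute[of u w])
qed

lemma det_kernel_matrix_nonzero:
  assumes "nondegenerate_on_kernel G w"
  shows "det (kernel_matrix G w) \<noteq> 0"
proof -
  have w: "w \<noteq> 0" using assms by (simp add: nondegenerate_on_kernel_def)
  have "inj ((*v) (kernel_matrix G w))"
  proof (rule injI)
    fix x y assume "kernel_matrix G w *v x = kernel_matrix G w *v y"
    from kernel_rhs_eqD[OF w this[unfolded kernel_matrix_mult]] show "x = y"
      using eq_if_nondegenerate_on_kernel[OF assms] by blast
  qed
  then show ?thesis
    by (metis invertible_det_nz invertible_left_inverse matrix_left_invertible_injective)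
qed

lemma kernel_solution:
  assumes "nondegenerate_on_kernel G w"
  shows "w \<bullet> kernel_solution G w c a = a"
    and "w \<bullet> u = 0 \<Longrightarrow> u \<bullet> (G *v kernel_solution G w c a) = u \<bullet> c"
proof -
  have w: "w \<noteq> 0" using assms by (simp add: nondegenerate_on_kernel_def)
  have "kernel_matrix G w *v kernel_solution G w c a = kernel_rhs w c a"
    using cramer[OF det_kernel_matrix_nonzero[OF assms]] unfolding kernel_solution_def by blast
  from kernel_rhs_eqD[OF w this[unfolded kernel_matrix_mult]]
  show "w \<bullet> kernel_solution G w c a = a"
    and "w \<bullet> u = 0 \<Longrightarrow> u \<bullet> (G *v kernel_solution G w c a) = u \<bullet> c" by auto
qed

text \<open>The index \<open>k\<close> is the lowered one.\<close>

definition christoffel ::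
  "(real^'n::finite \<Rightarrow> real^'n^'n) \<Rightarrow> real^'n \<Rightarrow> real^'n \<Rightarrow> real^'n \<Rightarrow> real^'n \<Rightarrow> real" where
  "christoffel G x u v k =
     (k \<bullet> (frechet_derivative G (at x) u *v v) + k \<bullet> (frechet_derivative G (at x) v *v u)
       - v \<bullet> (frechet_derivative G (at x) k *v u)) / 2"

text \<open>Takes vectors \<open>u\<close>, \<open>v\<close> rather than indices, so that its laws
  need no sums. The vector of symbols represents the functional k \<mapsto> [uv, k]; its component
  along \<open>w x\<close> has no influence, as \<open>kernel_rhs\<close> projects it out.\<close>

definition kropina_nabla ::
  "(real^'n::finite \<Rightarrow> real^'n^'n) \<Rightarrow> (real^'n \<Rightarrow> real^'n) \<Rightarrow> real^'n \<Rightarrow> real^'n \<Rightarrow> real^'n \<Rightarrow> real^'n" where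
  "kropina_nabla G w x u v = kernel_solution (G x) (w x)
     (\<chi> k. christoffel G x u v (axis k 1)) (frechet_derivative w (at x) u \<bullet> v)"

lemma christoffel_linear:
  assumes "G differentiable (at x)"
  shows "linear (\<lambda>u. christoffel G x u v k)" "linear (\<lambda>v. christoffel G x u v k)"
    "linear (\<lambda>k. christoffel G x u v k)"
  using linear_frechet_derivative[OF assms]
  by (auto intro!: linearI simp: christoffel_def linear_add linear_cmul inner_add_left inner_add_right
      matrix_vector_mult_add_rdistrib matrix_vector_right_distrib matrix_vector_mult_scaleR
      scaleR_matrix_vector_assoc[symmetric] add_divide_distrib diff_divide_distrib algebra_simps)

text \<open>These two properties determine the vector; apart from them, the explicit formula is used
  only for smoothness. Linearity of the Christoffel symbol in \<open>k\<close> passes from the axes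
  to all \<open>k\<close>.\<close>

lemma kropina_nabla:
  assumes "nondegenerate_on_kernel (G x) (w x)" "G differentiable (at x)"
  shows "w x \<bullet> kropina_nabla G w x u v = frechet_derivative w (at x) u \<bullet> v"
    and "w x \<bullet> k = 0 \<Longrightarrow> k \<bullet> (G x *v kropina_nabla G w x u v) = christoffel G x u v k"
proof -
  note s = kernel_solution[OF assms(1)]
  show "w x \<bullet> kropina_nabla G w x u v = frechet_derivative w (at x) u \<bullet> v"
    unfolding kropina_nabla_def by (rule s)
  assume "w x \<bullet> k = 0"
  from s(2)[OF this]
  have "k \<bullet> (G x *v kropina_nabla G w x u v) = k \<bullet> (\<chi> k. christoffel G x u v (axis k 1))"
    unfolding kropina_nabla_def .
  also have "\<dots> = christoffel G x u v k"
    using linear_expansion_axis[OF christoffel_linear(3)[OF assms(2)]] by (simp add: inner_vec_def)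
  finally show "k \<bullet> (G x *v kropina_nabla G w x u v) = christoffel G x u v k" .
qed

text \<open>Cramer's formula hides bilinearity. Both defining conditions are bilinear in
  \<open>u\<close> and \<open>v\<close>, so the double sum satisfies the conditions that single out
  the right side, and uniqueness applies.\<close>

lemma kropina_nabla_expansion:
  assumes nd: "nondegenerate_on_kernel (G x) (w x)" and G: "G differentiable (at x)"
    and w: "w differentiable (at x)"
  shows "(\<Sum>i\<in>UNIV. \<Sum>j\<in>UNIV. (u $ i * v $ j) *\<^sub>R kropina_nabla G w x (axis i 1) (axis j 1)) =
    kropina_nabla G w x u v"
    (is "?s = _")
proof (rule eq_if_nondegenerate_on_kernel[OF nd])
  have "linear (\<lambda>u. frechet_derivative w (at x) u \<bullet> v)" "linear (\<lambda>v. frechet_derivative w (at x) u \<bullet> v)" for u v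
    using linear_frechet_derivative[OF w]
    by (auto intro!: linearI simp: linear_add linear_cmul inner_add_left inner_add_right)
  from bilinear_expansion_axis[OF this, of u v]
  show "w x \<bullet> ?s = w x \<bullet> kropina_nabla G w x u v"
    by (simp add: inner_sum_right kropina_nabla[of G x w, OF nd G])
  fix k assume k: "w x \<bullet> k = 0"
  have "k \<bullet> (G x *v ?s) = (\<Sum>i\<in>UNIV. \<Sum>j\<in>UNIV. (u $ i * v $ j) *
      (k \<bullet> (G x *v kropina_nabla G w x (axis i 1) (axis j 1))))"
    by (simp add: linear_sum[OF matrix_vector_mul_linear] inner_sum_right matrix_vector_mult_scaleR)
  also have "\<dots> = christoffel G x u v k"
    using bilinear_expansion_axis[of "\<lambda>u v. christoffel G x u v k" u v] christoffel_linear[OF G]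
    by (simp add: kropina_nabla(2)[of G x w, OF nd G k])
  finally show "k \<bullet> (G x *v ?s) = k \<bullet> (G x *v kropina_nabla G w x u v)"
    by (simp add: kropina_nabla(2)[of G x w, OF nd G k])
qed

text \<open>Numerators and denominator of Cramer's quotient are polynomials in the entries of
  \<open>G\<close>, \<open>w\<close> and their first derivatives, and the denominator has no zero on
  \<open>S\<close>.\<close>

lemma smooth_on_kropina_nabla:
  assumes "open S" "smooth_on S G" "smooth_on S w"
    and nd: "\<And>x. x \<in> S \<Longrightarrow> nondegenerate_on_kernel (G x) (w x)"
  shows "smooth_on S (\<lambda>x. kropina_nabla G w x u v)"
  unfolding smooth_on_def
proof
  fix m
  note S = \<open>open S\<close>
  have G: "Ck_on m S G" and DG: "Ck_on m S (\<lambda>x. frechet_derivative G (at x) h)"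
    and w: "Ck_on m S w" and Dw: "Ck_on m S (\<lambda>x. frechet_derivative w (at x) h)" for h
    using assms smooth_on_frechet_derivative unfolding smooth_on_def by blast+
  have Gij: "Ck_on m S (\<lambda>x. G x $ i $ j)" and wi: "Ck_on m S (\<lambda>x. w x $ i)"
    and DGij: "Ck_on m S (\<lambda>x. frechet_derivative G (at x) h $ i $ j)" for i j h
    by (intro Ck_on_vec_nth S G w DG)+
  have DGv: "Ck_on m S (\<lambda>x. k \<bullet> (frechet_derivative G (at x) h *v l))" for k h l
    unfolding inner_vec_def matrix_vector_mult_def
    by (simp, intro Ck_on_sum[OF S] Ck_on_mult[OF S] Ck_on_const[OF S] DGij)
  have ch: "Ck_on m S (\<lambda>x. christoffel G x u v k)" for k
    unfolding christoffel_def
    by (intro Ck_on_divide[OF S] Ck_on_diff[OF S] Ck_on_add[OF S] DGv Ck_on_const[OF S]) simp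
  then have C: "Ck_on m S (\<lambda>x. \<chi> k. christoffel G x u v (axis k 1))"
    by (intro Ck_on_vec[OF S]) simp
  have r: "Ck_on m S (\<lambda>x. kernel_rhs (w x) (\<chi> k. christoffel G x u v (axis k 1))
      (frechet_derivative w (at x) u \<bullet> v))"
    unfolding kernel_rhs_def
    by (intro Ck_on_diff[OF S] Ck_on_add[OF S] Ck_on_scaleR[OF S] Ck_on_inner[OF S] w Dw C Ck_on_const[OF S])
  have M: "Ck_on m S (\<lambda>x. kernel_matrix (G x) (w x) $ i $ j)" for i j
    unfolding kernel_matrix_def column_def inner_vec_def
    by (simp, intro Ck_on_diff[OF S] Ck_on_add[OF S] Ck_on_mult[OF S] Ck_on_sum[OF S] Gij wi)
  have N: "Ck_on m S (\<lambda>x. det (\<chi> i j. if j = k then kernel_rhs (w x)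
      (\<chi> k. christoffel G x u v (axis k 1)) (frechet_derivative w (at x) u \<bullet> v) $ i
      else kernel_matrix (G x) (w x) $ i $ j))" for k
  proof (rule Ck_on_det[OF S])
    show "Ck_on m S (\<lambda>x. (\<chi> i j. if j = k then kernel_rhs (w x)
      (\<chi> k. christoffel G x u v (axis k 1)) (frechet_derivative w (at x) u \<bullet> v) $ i
      else kernel_matrix (G x) (w x) $ i $ j) $ i $ j)" for i j
      by (cases "j = k") (simp_all add: M Ck_on_vec_nth[OF S r])
  qed
  show "Ck_on m S (\<lambda>x. kropina_nabla G w x u v)"
    unfolding kropina_nabla_def kernel_solution_def
    by (rule Ck_on_vec[OF S]) (simp, intro Ck_on_divide[OF S] N Ck_on_det[OF S] M
      det_kernel_matrix_nonzero nd)
qed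

section \<open>Change of coordinates\<close>

text \<open>An overlap of two charts, freed from the atlas: \<open>T\<close> is the transition map,
  index 1 the source and index 2 the target. \<open>form\<close> and \<open>tensor\<close> are the
  classical laws paired with vectors; \<open>surj\<close> allows every test vector of the target
  chart to be pulled back.\<close>

locale coordinate_change =
  fixes T :: "real^'n::finite \<Rightarrow> real^'n" and U :: "(real^'n) set"
    and G1 G2 :: "real^'n \<Rightarrow> real^'n^'n" and w1 w2 :: "real^'n \<Rightarrow> real^'n"
  assumes open_U: "open U" and smooth_T: "smooth_on U T"
    and form: "\<And>x u. x \<in> U \<Longrightarrow> w1 x \<bullet> u = w2 (T x) \<bullet> frechet_derivative T (at x) u"
    and tensor: "\<And>x u v. x \<in> U \<Longrightarrow> u \<bullet> (G1 x *v v) =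
      frechet_derivative T (at x) u \<bullet> (G2 (T x) *v frechet_derivative T (at x) v)"
    and differentiable: "\<And>x. x \<in> U \<Longrightarrow> G1 differentiable (at x)" "\<And>x. x \<in> U \<Longrightarrow> w1 differentiable (at x)"
      "\<And>x. x \<in> U \<Longrightarrow> G2 differentiable (at (T x))" "\<And>x. x \<in> U \<Longrightarrow> w2 differentiable (at (T x))"
    and nondegenerate: "\<And>x. x \<in> U \<Longrightarrow> nondegenerate_on_kernel (G1 x) (w1 x)"
      "\<And>x. x \<in> U \<Longrightarrow> nondegenerate_on_kernel (G2 (T x)) (w2 (T x))"
    and surj: "\<And>x. x \<in> U \<Longrightarrow> surj (frechet_derivative T (at x))"
begin

abbreviation D :: "real^'n \<Rightarrow> real^'n \<Rightarrow> real^'n" where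
  "D x \<equiv> frechet_derivative T (at x)"

text \<open>The Hessian of \<open>T\<close>, source of the inhomogeneous term in the law of a
  connection.\<close>

definition second :: "real^'n \<Rightarrow> real^'n \<Rightarrow> real^'n \<Rightarrow> real^'n" where
  "second x h u = frechet_derivative (\<lambda>z. D z u) (at x) h"

lemma second_commute: "x \<in> U \<Longrightarrow> second x h u = second x u h"
  unfolding second_def by (rule frechet_derivative_symmetric_euclidean[OF smooth_T open_U])

lemma D_has_derivative: "x \<in> U \<Longrightarrow> ((\<lambda>z. D z u) has_derivative (\<lambda>h. second x h u)) (at x)"
  unfolding second_def by (rule smooth_on_has_derivative[OF smooth_on_frechet_derivative[OF smooth_T]])

lemma compose_has_derivative:
  assumes "x \<in> U" "f differentiable (at (T x))"
  shows "((\<lambda>z. f (T z)) has_derivative (\<lambda>h. frechet_derivative f (at (T x)) (D x h))) (at x)"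
  using diff_chain_at[OF smooth_on_has_derivative[OF smooth_T assms(1)]
      assms(2)[unfolded frechet_derivative_works]] by (simp add: o_def)

lemma form_derivative:
  assumes x: "x \<in> U"
  shows "frechet_derivative w1 (at x) h \<bullet> u =
    frechet_derivative w2 (at (T x)) (D x h) \<bullet> D x u + w2 (T x) \<bullet> second x h u"
proof -
  have 1: "((\<lambda>z. w1 z \<bullet> u) has_derivative (\<lambda>h. frechet_derivative w1 (at x) h \<bullet> u)) (at x)"
    by (rule bounded_linear.has_derivative[OF bounded_linear_inner_left
        differentiable(2)[OF x, unfolded frechet_derivative_works]])
  have "((\<lambda>z. w2 (T z) \<bullet> D z u) has_derivative (\<lambda>h. w2 (T x) \<bullet> second x h u +
      frechet_derivative w2 (at (T x)) (D x h) \<bullet> D x u)) (at x)"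
    by (rule bounded_bilinear.FDERIV[OF bounded_bilinear_inner
        compose_has_derivative[OF x differentiable(4)[OF x]] D_has_derivative[OF x]])
  then have "((\<lambda>z. w1 z \<bullet> u) has_derivative (\<lambda>h. w2 (T x) \<bullet> second x h u +
      frechet_derivative w2 (at (T x)) (D x h) \<bullet> D x u)) (at x)"
    by (rule has_derivative_transform_within_open[OF _ open_U x]) (simp add: form)
  from has_derivative_unique[OF 1 this] show ?thesis
    by (simp add: fun_eq_iff)
qed

lemma tensor_derivative:
  assumes x: "x \<in> U"
  shows "u \<bullet> (frechet_derivative G1 (at x) h *v v) =
    D x u \<bullet> (frechet_derivative G2 (at (T x)) (D x h) *v D x v)
    + D x u \<bullet> (G2 (T x) *v second x h v) + second x h u \<bullet> (G2 (T x) *v D x v)"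
proof -
  have 1: "((\<lambda>z. u \<bullet> (G1 z *v v)) has_derivative (\<lambda>h. u \<bullet> (frechet_derivative G1 (at x) h *v v))) (at x)"
    by (rule bounded_linear.has_derivative[OF bounded_linear_inner_right
        bounded_linear.has_derivative[OF bounded_bilinear.bounded_linear_left[OF
        bounded_bilinear_matrix_vector_mult] differentiable(1)[OF x, unfolded frechet_derivative_works]]])
  have "((\<lambda>z. D z u \<bullet> (G2 (T z) *v D z v)) has_derivative
      (\<lambda>h. D x u \<bullet> (G2 (T x) *v second x h v + frechet_derivative G2 (at (T x)) (D x h) *v D x v)
        + second x h u \<bullet> (G2 (T x) *v D x v))) (at x)"
    by (rule bounded_bilinear.FDERIV[OF bounded_bilinear_inner D_has_derivative[OF x]
        bounded_bilinear.FDERIV[OF bounded_bilinear_matrix_vector_mult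
        compose_has_derivative[OF x differentiable(3)[OF x]] D_has_derivative[OF x]]])
  then have "((\<lambda>z. u \<bullet> (G1 z *v v)) has_derivative
      (\<lambda>h. D x u \<bullet> (G2 (T x) *v second x h v + frechet_derivative G2 (at (T x)) (D x h) *v D x v)
        + second x h u \<bullet> (G2 (T x) *v D x v))) (at x)"
    by (rule has_derivative_transform_within_open[OF _ open_U x]) (simp add: tensor)
  from has_derivative_unique[OF 1 this] show ?thesis
    by (simp add: fun_eq_iff inner_add_right)
qed

text \<open>Three instances of \<open>tensor_derivative\<close> bring six Hessian terms. Symmetry of
  \<open>G2\<close> and of the Hessian cancels the four whose Hessian contains \<open>k\<close>; the
  other two coincide and absorb the factor 1/2.\<close>

lemma christoffel_transformation:
  assumes x: "x \<in> U"
  shows "christoffel G1 x u v k =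
    christoffel G2 (T x) (D x u) (D x v) (D x k) + D x k \<bullet> (G2 (T x) *v second x u v)"
proof -
  have "transpose (G2 (T x)) = G2 (T x)"
    using nondegenerate(2)[OF x] by (simp add: nondegenerate_on_kernel_def)
  note sym = symmetric_matrix_inner[OF this]
  have "second x u k \<bullet> (G2 (T x) *v D x v) = D x v \<bullet> (G2 (T x) *v second x k u)"
    "second x v k \<bullet> (G2 (T x) *v D x u) = second x k v \<bullet> (G2 (T x) *v D x u)"
    "second x v u = second x u v"
    using sym second_commute[OF x] by metis+
  then show ?thesis
    unfolding christoffel_def tensor_derivative[OF x] by (simp add: field_simps)
qed

theorem kropina_nabla_transformation:
  assumes x: "x \<in> U"
  shows "D x (kropina_nabla G1 w1 x u v) =
    kropina_nabla G2 w2 (T x) (D x u) (D x v) + second x u v"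
proof (rule eq_if_nondegenerate_on_kernel[OF nondegenerate(2)[OF x]])
  note n1 = kropina_nabla[of G1 x w1, OF nondegenerate(1)[OF x] differentiable(1)[OF x]]
  note n2 = kropina_nabla[of G2 "T x" w2, OF nondegenerate(2)[OF x] differentiable(3)[OF x]]
  show "w2 (T x) \<bullet> D x (kropina_nabla G1 w1 x u v) =
      w2 (T x) \<bullet> (kropina_nabla G2 w2 (T x) (D x u) (D x v) + second x u v)"
    using form[OF x, of "kropina_nabla G1 w1 x u v"]
    by (simp add: n1 n2 inner_add_right form_derivative[OF x])
  fix K assume K: "w2 (T x) \<bullet> K = 0"
  \<comment> \<open>The test vector belongs to the target chart; its preimage lies in the kernel of
    \<open>w1\<close>, where the defining condition of the source chart is available.\<close>
  obtain k where k: "K = D x k" using surj[OF x] by (metis surjD)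
  have "w1 x \<bullet> k = 0" using K form[OF x, of k] k by simp
  from n1(2)[OF this, of u v] tensor[OF x, of k "kropina_nabla G1 w1 x u v"]
  show "K \<bullet> (G2 (T x) *v D x (kropina_nabla G1 w1 x u v)) =
      K \<bullet> (G2 (T x) *v (kropina_nabla G2 w2 (T x) (D x u) (D x v) + second x u v))"
    using n2(2)[OF K] by (simp add: k christoffel_transformation[OF x] matrix_vector_right_distrib inner_add_right)
qed

end

section \<open>Overlaps of charts of an atlas as coordinate changes\<close>

lemma open_coord_image:
  assumes "smooth_atlas A" "c \<in> A" "open V" "V \<subseteq> dom c"
  shows "open (coord c ` V)"
proof -
  have c: "open (dom c)" "open (img c)"
    "homeomorphism (dom c) (img c) (coord c) (inv_into (dom c) (coord c))"
    using assms unfolding smooth_atlas_def by blast+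
  have "openin (top_of_set (img c)) (coord c ` V)"
    by (rule homeomorphism_imp_open_map[OF c(3)]) (use assms c in \<open>auto intro: open_subset\<close>)
  then show ?thesis using c(2) openin_open_trans by blast
qed

lemma transition_coord:
  assumes "smooth_atlas A" "c \<in> A" "p \<in> dom c"
  shows "transition c d (coord c p) = coord d p"
proof -
  have "homeomorphism (dom c) (img c) (coord c) (inv_into (dom c) (coord c))"
    using assms unfolding smooth_atlas_def by blast
  then show ?thesis using assms(3) by (simp add: transition_def homeomorphism_def)
qed

lemma transition_smooth:
  assumes "smooth_atlas A" "c \<in> A" "d \<in> A"
  shows "open (coord c ` (dom c \<inter> dom d))" "smooth_on (coord c ` (dom c \<inter> dom d)) (transition c d)"
proof -
  have "open (dom c)" "open (dom d)" using assms unfolding smooth_atlas_def by blast+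
  then show "open (coord c ` (dom c \<inter> dom d))"
    by (intro open_coord_image[OF assms(1,2)]) auto
  show "smooth_on (coord c ` (dom c \<inter> dom d)) (transition c d)"
    using assms unfolding smooth_atlas_def by blast
qed

lemma transition_partial_eq:
  assumes "smooth_atlas A" "c \<in> A" "d \<in> A" "x \<in> coord c ` (dom c \<inter> dom d)"
  shows "transition_partial c d i a x = frechet_derivative (transition c d) (at x) (axis i 1) $ a"
proof -
  note d = smooth_on_has_derivative[OF transition_smooth(2)[OF assms(1-3)] assms(4)]
  show ?thesis
    unfolding transition_partial_def partial_def
    using frechet_derivative_at[OF bounded_linear.has_derivative[OF bounded_linear_vec_nth d], of a] by metis
qed

text \<open>Differentiating the identity T S = id on the overlap, with S the transition in the
  opposite direction, exhibits a right inverse of the derivative of T.\<close>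

lemma surj_transition_derivative:
  assumes A: "smooth_atlas A" "c \<in> A" "d \<in> A" and x: "x \<in> coord c ` (dom c \<inter> dom d)"
  shows "surj (frechet_derivative (transition c d) (at x))"
proof -
  obtain p where p: "p \<in> dom c" "p \<in> dom d" "x = coord c p" using x by blast
  define y where "y = coord d p"
  have y: "y \<in> coord d ` (dom d \<inter> dom c)" using p by (simp add: y_def)
  have yx: "transition d c y = x"
    using transition_coord[OF A(1,3)] p by (simp add: y_def)
  note d1 = smooth_on_has_derivative[OF transition_smooth(2)[OF A] x]
  note d2 = smooth_on_has_derivative[OF transition_smooth(2)[OF A(1,3,2)] y]
  have "((\<lambda>z. transition c d (transition d c z)) has_derivative
      (\<lambda>h. frechet_derivative (transition c d) (at x) (frechet_derivative (transition d c) (at y) h))) (at y)"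
    using diff_chain_at[OF d2] d1 yx by (simp add: o_def)
  then have "((\<lambda>z. z) has_derivative
      (\<lambda>h. frechet_derivative (transition c d) (at x) (frechet_derivative (transition d c) (at y) h))) (at y)"
    by (rule has_derivative_transform_within_open[OF _ transition_smooth(1)[OF A(1,3,2)] y])
      (auto simp: transition_coord[OF A(1)] A(2,3))
  from has_derivative_unique[OF this has_derivative_ident] show ?thesis
    by (metis surjI)
qed

lemma one_form_transformation:
  assumes A: "smooth_atlas A" "c \<in> A" "d \<in> A" and w: "one_form A \<omega>"
    and x: "x \<in> coord c ` (dom c \<inter> dom d)"
  shows "\<omega> c x \<bullet> u = \<omega> d (transition c d x) \<bullet> frechet_derivative (transition c d) (at x) u"
proof -
  obtain p where p: "p \<in> dom c \<inter> dom d" "x = coord c p" using x by blast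
  have T: "transition c d x = coord d p" using transition_coord[OF A(1,2)] p by simp
  let ?D = "frechet_derivative (transition c d) (at x)"
  have comp: "\<omega> c x $ i = (\<Sum>a\<in>UNIV. \<omega> d (coord d p) $ a * transition_partial c d i a x)" for i
    using w A(2,3) p(1) unfolding one_form_def p(2) by blast
  have "linear ?D"
    using smooth_on_has_derivative[OF transition_smooth(2)[OF A] x] has_derivative_linear by blast
  then have "linear (\<lambda>u. \<omega> d (coord d p) \<bullet> ?D u)"
    by (auto intro!: linearI simp: linear_add linear_cmul inner_add_right)
  from linear_expansion_axis[OF this, of u]
  have "\<omega> d (coord d p) \<bullet> ?D u = (\<Sum>i\<in>UNIV. u $ i * (\<omega> d (coord d p) \<bullet> ?D (axis i 1)))" by simp
  also have "\<dots> = (\<Sum>i\<in>UNIV. u $ i * \<omega> c x $ i)"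
    by (simp add: comp transition_partial_eq[OF A x] inner_vec_def)
  also have "\<dots> = \<omega> c x \<bullet> u" by (simp add: inner_vec_def mult.commute)
  finally show ?thesis by (simp add: T)
qed

lemma symmetric_2_tensor_transformation:
  assumes A: "smooth_atlas A" "c \<in> A" "d \<in> A" and g: "symmetric_2_tensor A g"
    and x: "x \<in> coord c ` (dom c \<inter> dom d)"
  shows "u \<bullet> (g c x *v v) = frechet_derivative (transition c d) (at x) u \<bullet>
    (g d (transition c d x) *v frechet_derivative (transition c d) (at x) v)"
proof -
  obtain p where p: "p \<in> dom c \<inter> dom d" "x = coord c p" using x by blast
  have T: "transition c d x = coord d p" using transition_coord[OF A(1,2)] p by simp
  let ?D = "frechet_derivative (transition c d) (at x)"
  let ?f = "\<lambda>u v. ?D u \<bullet> (g d (coord d p) *v ?D v)"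
  have "linear ?D"
    using smooth_on_has_derivative[OF transition_smooth(2)[OF A] x] has_derivative_linear by blast
  then have lin: "linear (\<lambda>u. ?f u v)" "linear (?f u)" for u v
    by (auto intro!: linearI simp: linear_add linear_cmul inner_add_right inner_add_left
        matrix_vector_right_distrib matrix_vector_mult_scaleR)
  have f: "?f (axis i 1) (axis j 1) = g c x $ i $ j" for i j
  proof -
    have "g c x $ i $ j = (\<Sum>a\<in>UNIV. \<Sum>b\<in>UNIV. g d (coord d p) $ a $ b *
        transition_partial c d i a x * transition_partial c d j b x)"
      using g A(2,3) p(1) unfolding symmetric_2_tensor_def p(2) by blast
    then show ?thesis
      by (simp add: transition_partial_eq[OF A x] inner_vec_def matrix_vector_mult_def sum_distrib_left mult_ac)
  qed
  from bilinear_expansion_axis[OF lin, of u v]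
  have "?f u v = (\<Sum>i\<in>UNIV. \<Sum>j\<in>UNIV. u $ i * v $ j * g c x $ i $ j)" by (simp add: f)
  also have "(\<Sum>i\<in>UNIV. \<Sum>j\<in>UNIV. u $ i * v $ j * g c x $ i $ j) = u \<bullet> (g c x *v v)"
    by (simp add: inner_vec_def matrix_vector_mult_def sum_distrib_left mult_ac)
  finally show ?thesis by (simp add: T)
qed

lemma kropina_data_nondegenerate:
  assumes "kropina_data A g \<omega>" "c \<in> A" "x \<in> img c"
  shows "nondegenerate_on_kernel (g c x) (\<omega> c x)"
proof -
  have "symmetric_2_tensor A g" using assms unfolding kropina_data_def by blast
  then have "\<forall>i j. g c x $ i $ j = g c x $ j $ i"
    using assms(2,3) unfolding symmetric_2_tensor_def by blast
  then have t: "transpose (g c x) = g c x" by (simp add: vec_eq_iff transpose_def)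
  have "\<omega> c x \<noteq> 0" "\<forall>v. \<omega> c x \<bullet> v = 0 \<and>
      (\<forall>w. \<omega> c x \<bullet> w = 0 \<longrightarrow> v \<bullet> (g c x *v w) = 0) \<longrightarrow> v = 0"
    using assms unfolding kropina_data_def by blast+
  then show ?thesis
    unfolding nondegenerate_on_kernel_def using t symmetric_matrix_inner[OF t] by auto
qed

lemma kropina_coordinate_change:
  assumes A: "smooth_atlas A" "c \<in> A" "d \<in> A" and k: "kropina_data A g \<omega>"
  shows "coordinate_change (transition c d) (coord c ` (dom c \<inter> dom d)) (g c) (g d) (\<omega> c) (\<omega> d)"
proof
  have g: "symmetric_2_tensor A g" and w: "one_form A \<omega>"
    using k by (auto simp: kropina_data_def)
  have sm: "smooth_on (img c) (g c)" "smooth_on (img c) (\<omega> c)"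
    "smooth_on (img d) (g d)" "smooth_on (img d) (\<omega> d)"
    using g w A by (auto simp: symmetric_2_tensor_def one_form_def)
  note sd = smooth_on_Suc_iff[THEN iffD1, THEN conjunct1, rule_format]
  show "open (coord c ` (dom c \<inter> dom d))" "smooth_on (coord c ` (dom c \<inter> dom d)) (transition c d)"
    by (rule transition_smooth[OF A])+
  fix x assume x: "x \<in> coord c ` (dom c \<inter> dom d)"
  then have xc: "x \<in> img c" by (auto simp: img_def)
  have xd: "transition c d x \<in> img d"
    using x by (auto simp: img_def transition_coord[OF A(1,2), of _ d])
  show "\<omega> c x \<bullet> u = \<omega> d (transition c d x) \<bullet> frechet_derivative (transition c d) (at x) u" for u
    by (rule one_form_transformation[OF A w x])
  show "u \<bullet> (g c x *v v) = frechet_derivative (transition c d) (at x) u \<bullet>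
    (g d (transition c d x) *v frechet_derivative (transition c d) (at x) v)" for u v
    by (rule symmetric_2_tensor_transformation[OF A g x])
  show "g c differentiable (at x)" "\<omega> c differentiable (at x)"
    "g d differentiable (at (transition c d x))" "\<omega> d differentiable (at (transition c d x))"
    using sd[OF sm(1) xc] sd[OF sm(2) xc] sd[OF sm(3) xd] sd[OF sm(4) xd] by auto
  show "nondegenerate_on_kernel (g c x) (\<omega> c x)"
    "nondegenerate_on_kernel (g d (transition c d x)) (\<omega> d (transition c d x))"
    by (rule kropina_data_nondegenerate[OF k A(2) xc] kropina_data_nondegenerate[OF k A(3) xd])+
  show "surj (frechet_derivative (transition c d) (at x))"
    by (rule surj_transition_derivative[OF A x])
qed

section \<open>The connection on the manifold\<close>

definition kropina_connection ::
  "(('m, 'n::finite) chart \<Rightarrow> real^'n \<Rightarrow> real^'n^'n) \<Rightarrow> (('m, 'n) chart \<Rightarrow> real^'n \<Rightarrow> real^'n) \<Rightarrow>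
   ('m, 'n) chart \<Rightarrow> real^'n \<Rightarrow> real^'n^'n^'n" where
  "kropina_connection g \<omega> c x = (\<chi> i j. kropina_nabla (g c) (\<omega> c) x (axis i 1) (axis j 1))"

text \<open>The classical law is component \<open>a\<close> of
  \<open>kropina_nabla_transformation\<close> at two axes: the sum over \<open>k\<close> is the
  derivative of the transition map applied to a vector, the double sum is a bilinear expansion, and
  the last term is the Hessian.\<close>

theorem affine_connection_kropina:
  assumes A: "smooth_atlas A" and k: "kropina_data A g \<omega>"
  shows "affine_connection A (kropina_connection g \<omega>)"
  unfolding affine_connection_def
proof (intro conjI ballI allI)
  fix c assume c: "c \<in> A"
  have o: "open (img c)" using A c by (auto simp: smooth_atlas_def)
  have "smooth_on (img c) (g c)" "smooth_on (img c) (\<omega> c)"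
    using k c by (auto simp: kropina_data_def symmetric_2_tensor_def one_form_def)
  from smooth_on_kropina_nabla[OF o this kropina_data_nondegenerate[OF k c]]
  show "smooth_on (img c) (kropina_connection g \<omega> c)"
    unfolding smooth_on_def kropina_connection_def
    by (intro allI Ck_on_vec[OF o]) (simp add: Ck_on_vec_nth[OF o])
next
  fix c d p i j a
  assume c: "c \<in> A" and d: "d \<in> A" and p: "p \<in> dom c \<inter> dom d"
  interpret coordinate_change "transition c d" "coord c ` (dom c \<inter> dom d)" "g c" "g d" "\<omega> c" "\<omega> d"
    by (rule kropina_coordinate_change[OF A c d k])
  define x where "x = coord c p"
  have x: "x \<in> coord c ` (dom c \<inter> dom d)" using p by (simp add: x_def)
  have T: "transition c d x = coord d p" using transition_coord[OF A c] p by (simp add: x_def)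
  note tp = transition_partial_eq[OF A c d]
  let ?n = "kropina_nabla (g c) (\<omega> c) x (axis i 1) (axis j 1)"
  have lin: "linear (\<lambda>u. D x u $ a)"
    using linear_compose[OF has_derivative_linear[OF smooth_on_has_derivative[OF smooth_T x]]
      bounded_linear.linear[OF bounded_linear_vec_nth[of a]]] by (simp add: o_def)
  have lhs: "(\<Sum>k\<in>UNIV. kropina_connection g \<omega> c x $ i $ j $ k * transition_partial c d k a x) = D x ?n $ a"
    using linear_expansion_axis[OF lin, of ?n] by (simp add: kropina_connection_def tp[OF x])
  have rhs: "(\<Sum>r\<in>UNIV. \<Sum>s\<in>UNIV. kropina_connection g \<omega> d (coord d p) $ r $ s $ a *
      transition_partial c d i r x * transition_partial c d j s x) =
      kropina_nabla (g d) (\<omega> d) (transition c d x) (D x (axis i 1)) (D x (axis j 1)) $ a"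
    by (subst kropina_nabla_expansion[of "g d" "transition c d x" "\<omega> d", OF nondegenerate(2)[OF x]
        differentiable(3,4)[OF x], symmetric])
      (simp add: kropina_connection_def tp[OF x] T mult_ac)
  have "((\<lambda>z. D z (axis j 1) $ a) has_derivative (\<lambda>h. second x h (axis j 1) $ a)) (at x)"
    by (rule bounded_linear.has_derivative[OF bounded_linear_vec_nth D_has_derivative[OF x]])
  then have "(transition_partial c d j a has_derivative (\<lambda>h. second x h (axis j 1) $ a)) (at x)"
    by (rule has_derivative_transform_within_open[OF _ open_U x]) (simp add: tp)
  from frechet_derivative_at[OF this, symmetric]
  have "partial i (transition_partial c d j a) x = second x (axis i 1) (axis j 1) $ a"
    by (simp add: partial_def)
  with lhs rhs kropina_nabla_transformation[OF x, of "axis i 1" "axis j 1"]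
  show "(\<Sum>k\<in>UNIV. kropina_connection g \<omega> c (coord c p) $ i $ j $ k * transition_partial c d k a (coord c p)) =
        (\<Sum>r\<in>UNIV. \<Sum>s\<in>UNIV. kropina_connection g \<omega> d (coord d p) $ r $ s $ a *
           transition_partial c d i r (coord c p) * transition_partial c d j s (coord c p))
        + partial i (transition_partial c d j a) (coord c p)"
    by (simp add: x_def)
qed

section \<open>The Euler-Lagrange equation\<close>

lemma has_vector_derivative_compose:
  assumes "(f has_derivative D) (at (x t))" "(x has_vector_derivative v) (at t)"
  shows "((\<lambda>s. f (x s)) has_vector_derivative D v) (at t)"
proof -
  have "((\<lambda>s. f (x s)) has_derivative (\<lambda>r. D (r *\<^sub>R v))) (at t)"
    using diff_chain_at[OF assms(2)[unfolded has_vector_derivative_def] assms(1)] by (simp add: o_def)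
  then show ?thesis
    unfolding has_vector_derivative_def
    by (rule has_derivative_eq_rhs) (simp add: fun_eq_iff linear_cmul[OF has_derivative_linear[OF assms(1)]])
qed

lemma linear_mult_left:
  fixes f :: "'a::real_vector \<Rightarrow> real"
  shows "linear f \<Longrightarrow> linear (\<lambda>h. a * f h)"
  by (rule linearI) (simp_all add: linear_add linear_cmul algebra_simps)

text \<open>The quotient rule is regrouped so that \<omega> of the direction is a separate factor,
  which vanishes on contraction with a kernel vector. The 2 comes from the symmetry of
  \<open>g\<close>.\<close>

lemma partial_velocity_kropina:
  assumes "\<omega> c x \<bullet> v \<noteq> 0" "transpose (g c x) = g c x"
  shows "partial i (kropina g \<omega> c x) v =
    2 * (axis i 1 \<bullet> (g c x *v v)) / (\<omega> c x \<bullet> v)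
      - (v \<bullet> (g c x *v v)) / (\<omega> c x \<bullet> v)\<^sup>2 * (\<omega> c x \<bullet> axis i 1)"
proof -
  have q: "((\<lambda>v. v \<bullet> (g c x *v v)) has_derivative (\<lambda>h. 2 * (h \<bullet> (g c x *v v)))) (at v)"
    by (rule has_derivative_eq_rhs[OF bounded_bilinear.FDERIV[OF bounded_bilinear_inner
        has_derivative_ident bounded_linear.has_derivative[OF matrix_vector_mul_bounded_linear
        has_derivative_ident]]])
      (simp add: fun_eq_iff symmetric_matrix_inner[OF assms(2), of v])
  have w: "((\<lambda>v. \<omega> c x \<bullet> v) has_derivative (\<lambda>h. \<omega> c x \<bullet> h)) (at v)"
    by (rule bounded_linear.has_derivative[OF bounded_linear_inner_right has_derivative_ident])
  have "(kropina g \<omega> c x has_derivative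
      (\<lambda>h. 2 * (h \<bullet> (g c x *v v)) / (\<omega> c x \<bullet> v)
        - (v \<bullet> (g c x *v v)) / (\<omega> c x \<bullet> v)\<^sup>2 * (\<omega> c x \<bullet> h))) (at v)"
    unfolding kropina_def
    by (rule has_derivative_eq_rhs[OF has_derivative_divide'[OF q w assms(1)]])
      (use assms(1) in \<open>simp add: fun_eq_iff field_simps power2_eq_square\<close>)
  from frechet_derivative_at[OF this, symmetric] show ?thesis
    by (simp add: partial_def)
qed

lemma partial_position_kropina:
  assumes "\<omega> c x \<bullet> v \<noteq> 0" "g c differentiable (at x)" "\<omega> c differentiable (at x)"
  shows "partial i (\<lambda>z. kropina g \<omega> c z v) x =
    (v \<bullet> (frechet_derivative (g c) (at x) (axis i 1) *v v)) / (\<omega> c x \<bullet> v)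
      - (v \<bullet> (g c x *v v)) / (\<omega> c x \<bullet> v)\<^sup>2 * (frechet_derivative (\<omega> c) (at x) (axis i 1) \<bullet> v)"
proof -
  note dg = assms(2)[unfolded frechet_derivative_works]
  note dw = assms(3)[unfolded frechet_derivative_works]
  have q: "((\<lambda>z. v \<bullet> (g c z *v v)) has_derivative
      (\<lambda>h. v \<bullet> (frechet_derivative (g c) (at x) h *v v))) (at x)"
    by (rule bounded_linear.has_derivative[OF bounded_linear_inner_right
        bounded_linear.has_derivative[OF bounded_bilinear.bounded_linear_left[OF
        bounded_bilinear_matrix_vector_mult] dg]])
  have w: "((\<lambda>z. \<omega> c z \<bullet> v) has_derivative (\<lambda>h. frechet_derivative (\<omega> c) (at x) h \<bullet> v)) (at x)"
    by (rule bounded_linear.has_derivative[OF bounded_linear_inner_left dw])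
  have "((\<lambda>z. kropina g \<omega> c z v) has_derivative
      (\<lambda>h. (v \<bullet> (frechet_derivative (g c) (at x) h *v v)) / (\<omega> c x \<bullet> v)
      - (v \<bullet> (g c x *v v)) / (\<omega> c x \<bullet> v)\<^sup>2 * (frechet_derivative (\<omega> c) (at x) h \<bullet> v))) (at x)"
    unfolding kropina_def
    by (rule has_derivative_eq_rhs[OF has_derivative_divide'[OF q w assms(1)]])
      (use assms(1) in \<open>simp add: fun_eq_iff field_simps power2_eq_square\<close>)
  from frechet_derivative_at[OF this, symmetric] show ?thesis
    by (simp add: partial_def)
qed

text \<open>Contracting the Euler-Lagrange equation with \<open>k\<close> in the kernel of \<open>\<omega>\<close> removes the
  derivative of \<open>g(\<xi>, \<xi>) / \<omega>(\<xi>)\<^sup>2\<close>, and closedness cancels the two terms with derivatives of \<open>\<omega>\<close>.\<close>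

lemma kropina_euler_lagrange_contracted:
  fixes x :: "real \<Rightarrow> real^'n::finite" and t :: real
  defines "\<xi> \<equiv> velocity x t"
  assumes T: "open T" "t \<in> T"
    and W: "\<And>s. s \<in> T \<Longrightarrow> \<omega> c (x s) \<bullet> velocity x s \<noteq> 0"
    and sym: "\<And>s. s \<in> T \<Longrightarrow> transpose (g c (x s)) = g c (x s)"
    and dg: "g c differentiable (at (x t))" and dw: "\<omega> c differentiable (at (x t))"
    and closed: "\<And>u v. frechet_derivative (\<omega> c) (at (x t)) u \<bullet> v = frechet_derivative (\<omega> c) (at (x t)) v \<bullet> u"
    and x: "(x has_vector_derivative \<xi>) (at t)" and a: "(velocity x has_vector_derivative a) (at t)"
    and W': "((\<lambda>s. \<omega> c (x s) \<bullet> velocity x s) has_real_derivative W') (at t)"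
    and EL: "euler_lagrange_at (kropina g \<omega> c) x t"
    and k: "\<omega> c (x t) \<bullet> k = 0"
  shows "k \<bullet> (g c (x t) *v a) + christoffel (g c) (x t) \<xi> \<xi> k =
    W' / (\<omega> c (x t) \<bullet> \<xi>) * (k \<bullet> (g c (x t) *v \<xi>))"
proof -
  define W where "W = (\<lambda>s. \<omega> c (x s) \<bullet> velocity x s)"
  \<comment> \<open>\<open>p h\<close> and \<open>q h\<close> are the derivatives of the Lagrangian
    in fibre and base direction \<open>h\<close>. Both are linear in \<open>h\<close>, so the
    coordinate equations add up, with the weights \<open>k $ i\<close>, to one equation along
    \<open>k\<close>.\<close>
  define p where "p = (\<lambda>h s. 2 / W s * (h \<bullet> (g c (x s) *v velocity x s))
      - (velocity x s \<bullet> (g c (x s) *v velocity x s)) / (W s)\<^sup>2 * (\<omega> c (x s) \<bullet> h))"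
  define q where "q = (\<lambda>h. 1 / W t * (\<xi> \<bullet> (frechet_derivative (g c) (at (x t)) h *v \<xi>))
      - (\<xi> \<bullet> (g c (x t) *v \<xi>)) / (W t)\<^sup>2 * (frechet_derivative (\<omega> c) (at (x t)) h \<bullet> \<xi>))"
  note dg' = dg[unfolded frechet_derivative_works] and dw' = dw[unfolded frechet_derivative_works]
  have Wt: "W t \<noteq> 0" using W T by (simp add: W_def)
  have el: "(p (axis i 1) has_real_derivative q (axis i 1)) (at t)" for i
  proof (rule has_field_derivative_transform_within_open[OF _ T])
    have pp: "partial i (\<lambda>z. kropina g \<omega> c z \<xi>) (x t) = q (axis i 1)"
      using partial_position_kropina[of \<omega> c "x t" \<xi> g i] dg dw Wt
      by (simp add: q_def W_def \<xi>_def)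
    show "((\<lambda>s. partial i (kropina g \<omega> c (x s)) (velocity x s)) has_real_derivative q (axis i 1)) (at t)"
      using EL[unfolded euler_lagrange_at_def, rule_format, of i] unfolding \<xi>_def[symmetric] pp .
    show "partial i (kropina g \<omega> c (x s)) (velocity x s) = p (axis i 1) s" if "s \<in> T" for s
      using partial_velocity_kropina[of \<omega> c "x s" "velocity x s" g i, OF W[OF that] sym[OF that]]
      by (simp add: p_def W_def)
  qed
  have "linear (\<lambda>h. p h s)" for s
    unfolding p_def
    by (intro linear_compose_sub linear_mult_left
      bounded_linear.linear[OF bounded_linear_inner_left] bounded_linear.linear[OF bounded_linear_inner_right])
  note p_exp = linear_expansion_axis[OF this]
  have "linear q"
    unfolding q_def
    using linear_compose[OF linear_compose[OF linear_frechet_derivative[OF dg]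
        linear_matrix_vector_mult_left[of \<xi>]] bounded_linear.linear[OF bounded_linear_inner_right[of \<xi>]]]
      linear_compose[OF linear_frechet_derivative[OF dw] bounded_linear.linear[OF bounded_linear_inner_left[of \<xi>]]]
    by (intro linear_compose_sub linear_mult_left) (simp_all add: o_def)
  note q_exp = linear_expansion_axis[OF this]
  have "((\<lambda>s. \<Sum>i\<in>UNIV. k $ i *\<^sub>R p (axis i 1) s) has_real_derivative
      (\<Sum>i\<in>UNIV. k $ i *\<^sub>R q (axis i 1))) (at t)"
    by (auto intro!: DERIV_sum DERIV_cmult el)
  then have el_k: "(p k has_real_derivative q k) (at t)"
    using p_exp[of k] q_exp[of k] by simp
  have G: "((\<lambda>s. g c (x s) *v velocity x s) has_vector_derivative
      g c (x t) *v a + frechet_derivative (g c) (at (x t)) \<xi> *v \<xi>) (at t)"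
    unfolding \<xi>_def
    by (rule bounded_bilinear.has_vector_derivative[OF bounded_bilinear_matrix_vector_mult
        has_vector_derivative_compose[OF dg' x[unfolded \<xi>_def]] a])
  have A: "((\<lambda>s. k \<bullet> (g c (x s) *v velocity x s)) has_real_derivative
      k \<bullet> (g c (x t) *v a) + k \<bullet> (frechet_derivative (g c) (at (x t)) \<xi> *v \<xi>)) (at t)"
    using bounded_linear.has_vector_derivative[OF bounded_linear_inner_right G, of k]
    by (simp add: has_real_derivative_iff_has_vector_derivative inner_add_right)
  \<comment> \<open>The values of \<open>Q'\<close> and of \<open>R'\<close> below need not be
    known: in the product rule \<open>R'\<close> meets the factor \<omega>(k), which is zero at
    \<open>t\<close>.\<close>
  obtain Q' where "((\<lambda>s. velocity x s \<bullet> (g c (x s) *v velocity x s)) has_real_derivative Q') (at t)"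
    using bounded_bilinear.has_vector_derivative[OF bounded_bilinear_inner a G]
    by (auto simp: has_real_derivative_iff_has_vector_derivative)
  from DERIV_divide[OF this DERIV_power[OF W', where n = 2]] Wt
  obtain R' where R: "((\<lambda>s. (velocity x s \<bullet> (g c (x s) *v velocity x s)) / (W s)\<^sup>2) has_real_derivative R') (at t)"
    by (auto simp: W_def)
  \<comment> \<open>The vector \<open>k\<close> is constant in \<open>s\<close> and is assumed to
    lie in the kernel only at \<open>t\<close>, so the derivative of \<omega>(k) along the curve
    survives.\<close>
  have B: "((\<lambda>s. \<omega> c (x s) \<bullet> k) has_real_derivative frechet_derivative (\<omega> c) (at (x t)) \<xi> \<bullet> k) (at t)"
    using bounded_linear.has_vector_derivative[OF bounded_linear_inner_left
        has_vector_derivative_compose[OF dw' x], of k]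
    by (simp add: has_real_derivative_iff_has_vector_derivative)
  have p_k: "p k = (\<lambda>s. 2 * (k \<bullet> (g c (x s) *v velocity x s)) / W s
      - (velocity x s \<bullet> (g c (x s) *v velocity x s)) / (W s)\<^sup>2 * (\<omega> c (x s) \<bullet> k))"
    by (simp add: p_def fun_eq_iff)
  from DERIV_diff[OF DERIV_divide[OF DERIV_cmult[OF A, of 2] W'[folded W_def] Wt] DERIV_mult[OF R B],
      folded p_k]
  have "q k = (2 * (k \<bullet> (g c (x t) *v a) + k \<bullet> (frechet_derivative (g c) (at (x t)) \<xi> *v \<xi>)) * W t
      - 2 * (k \<bullet> (g c (x t) *v \<xi>)) * W') / (W t * W t)
      - (\<xi> \<bullet> (g c (x t) *v \<xi>)) / (W t)\<^sup>2 * (frechet_derivative (\<omega> c) (at (x t)) \<xi> \<bullet> k)"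
    using DERIV_unique[OF el_k] by (fastforce simp: k \<xi>_def mult_ac)
  then have "(\<xi> \<bullet> (frechet_derivative (g c) (at (x t)) k *v \<xi>)) / W t =
      (2 * (k \<bullet> (g c (x t) *v a) + k \<bullet> (frechet_derivative (g c) (at (x t)) \<xi> *v \<xi>)) * W t
      - 2 * (k \<bullet> (g c (x t) *v \<xi>)) * W') / (W t * W t)"
    using closed[of k \<xi>] by (simp add: q_def)
  then have "k \<bullet> (g c (x t) *v a) + christoffel (g c) (x t) \<xi> \<xi> k = W' / W t * (k \<bullet> (g c (x t) *v \<xi>))"
    using Wt by (simp add: christoffel_def field_simps)
  then show ?thesis by (simp add: W_def \<xi>_def)
qed

text \<open>Tested with \<omega>, both sides give W': it equals \<omega>(a) + D\<omega>(\<xi>)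
  \<bullet> \<xi>, and the last term is \<omega> of the connection vector. Tested with the kernel,
  the equation is the contracted Euler-Lagrange equation.\<close>

lemma kropina_euler_lagrange_imp_nabla:
  fixes x :: "real \<Rightarrow> real^'n::finite" and t :: real
  defines "\<xi> \<equiv> velocity x t"
  assumes T: "open T" "t \<in> T"
    and W: "\<And>s. s \<in> T \<Longrightarrow> \<omega> c (x s) \<bullet> velocity x s \<noteq> 0"
    and nd: "\<And>s. s \<in> T \<Longrightarrow> nondegenerate_on_kernel (g c (x s)) (\<omega> c (x s))"
    and dg: "g c differentiable (at (x t))" and dw: "\<omega> c differentiable (at (x t))"
    and closed: "\<And>u v. frechet_derivative (\<omega> c) (at (x t)) u \<bullet> v = frechet_derivative (\<omega> c) (at (x t)) v \<bullet> u"
    and x: "(x has_vector_derivative \<xi>) (at t)" and a: "(velocity x has_vector_derivative a) (at t)"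
    and W': "((\<lambda>s. \<omega> c (x s) \<bullet> velocity x s) has_real_derivative W') (at t)"
    and EL: "euler_lagrange_at (kropina g \<omega> c) x t"
  shows "a + kropina_nabla (g c) (\<omega> c) (x t) \<xi> \<xi> = (W' / (\<omega> c (x t) \<bullet> \<xi>)) *\<^sub>R \<xi>"
proof (rule eq_if_nondegenerate_on_kernel[OF nd[OF T(2)]])
  note n = kropina_nabla[of "g c" "x t" "\<omega> c", OF nd[OF T(2)] dg]
  have sym: "transpose (g c (x s)) = g c (x s)" if "s \<in> T" for s
    using nd[OF that] by (simp add: nondegenerate_on_kernel_def)
  have "((\<lambda>s. \<omega> c (x s) \<bullet> velocity x s) has_real_derivative
      \<omega> c (x t) \<bullet> a + frechet_derivative (\<omega> c) (at (x t)) \<xi> \<bullet> \<xi>) (at t)"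
    using bounded_bilinear.has_vector_derivative[OF bounded_bilinear_inner
        has_vector_derivative_compose[OF dw[unfolded frechet_derivative_works] x] a]
    by (simp add: has_real_derivative_iff_has_vector_derivative \<xi>_def)
  from DERIV_unique[OF W' this]
  show "\<omega> c (x t) \<bullet> (a + kropina_nabla (g c) (\<omega> c) (x t) \<xi> \<xi>) =
      \<omega> c (x t) \<bullet> (W' / (\<omega> c (x t) \<bullet> \<xi>)) *\<^sub>R \<xi>"
    using W[OF T(2)] by (simp add: inner_add_right n \<xi>_def)
  fix k assume k: "\<omega> c (x t) \<bullet> k = 0"
  show "k \<bullet> (g c (x t) *v (a + kropina_nabla (g c) (\<omega> c) (x t) \<xi> \<xi>)) =
      k \<bullet> (g c (x t) *v ((W' / (\<omega> c (x t) \<bullet> \<xi>)) *\<^sub>R \<xi>))"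
    using kropina_euler_lagrange_contracted[OF T W sym dg dw closed x[unfolded \<xi>_def] a W' EL k]
    by (simp add: matrix_vector_right_distrib inner_add_right n(2)[OF k] matrix_vector_mult_scaleR \<xi>_def)
qed

section \<open>Change of parameter\<close>

lemma open_interval_antiderivative:
  fixes W :: "real \<Rightarrow> real"
  assumes "open_interval I" "continuous_on I W"
  obtains F where "\<And>t. t \<in> I \<Longrightarrow> (F has_real_derivative W t) (at t)"
proof -
  obtain t0 where t0: "t0 \<in> I" and I: "open I" "is_interval I"
    using assms unfolding open_interval_def by blast
  \<comment> \<open>An integral with reversed bounds is over the empty set and vanishes, so the
    difference is the oriented integral from \<open>t0\<close> to \<open>t\<close> on both sides of
    \<open>t0\<close>.\<close>
  define F where "F = (\<lambda>t. integral {t0..t} W - integral {t..t0} W)"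
  have "(F has_real_derivative W t) (at t)" if t: "t \<in> I" for t
  proof -
    have "min t t0 \<in> I" "max t t0 \<in> I" using t t0 by (auto simp: min_def max_def)
    then obtain e d where e: "e > 0" "ball (min t t0) e \<subseteq> I" and d: "d > 0" "ball (max t t0) d \<subseteq> I"
      using I by (meson open_contains_ball)
    \<comment> \<open>The margins put \<open>t\<close> and \<open>t0\<close> in the interior of an
      interval inside \<open>I\<close>: the derivative within it is then two-sided, and near
      \<open>t\<close> the oriented integral differs from the integral from \<open>a\<close> by a
      constant.\<close>
    define a b where "a = min t t0 - e / 2" and "b = max t t0 + d / 2"
    have "a \<in> ball (min t t0) e" "b \<in> ball (max t t0) d"
      using e(1) d(1) by (simp_all add: a_def b_def dist_real_def)
    then have "a \<in> I" "b \<in> I" using e(2) d(2) by blast+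
    then have sub: "{a..b} \<subseteq> I"
      using I(2) unfolding is_interval_1 by (meson atLeastAtMost_iff subsetI)
    have ab: "a < t" "a < t0" "t < b" "t0 < b"
      using e(1) d(1) by (simp_all add: a_def b_def min_def max_def)
    have c: "continuous_on {a..b} W" using assms(2) sub continuous_on_subset by blast
    have "((\<lambda>u. integral {a..u} W) has_real_derivative W t) (at t within {a..b})"
      using integral_has_real_derivative[OF c] ab by simp
    then have "((\<lambda>u. integral {a..u} W) has_real_derivative W t) (at t)"
      using ab at_within_interior[of t "{a..b}"] by (simp add: interior_atLeastAtMost_real)
    then have "((\<lambda>u. integral {a..u} W - integral {a..t0} W) has_real_derivative W t) (at t)"
      by (auto intro!: derivative_eq_intros)
    moreover have "integral {a..u} W - integral {a..t0} W = F u" if u: "u \<in> {a<..<b}" for u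
    proof (cases "t0 \<le> u")
      case True
      have "integral {a..t0} W + integral {t0..u} W = integral {a..u} W"
        using True u ab c
        by (intro Henstock_Kurzweil_Integration.integral_combine integrable_continuous_real)
          (auto intro: continuous_on_subset)
      then show ?thesis using True by (cases "u = t0") (auto simp: F_def)
    next
      case False
      have "integral {a..u} W + integral {u..t0} W = integral {a..t0} W"
        using False u ab c
        by (intro Henstock_Kurzweil_Integration.integral_combine integrable_continuous_real)
          (auto intro: continuous_on_subset)
      then show ?thesis using False by (auto simp: F_def)
    qed
    ultimately show ?thesis
      using has_field_derivative_transform_within_open[of _ _ t "{a<..<b}" F] ab by simp
  qed
  then show ?thesis using that by blast
qed

text \<open>The new parameter is s = F(t) with F' = W, and \<open>r\<close> is the inverse of
  \<open>F\<close>. The mean value theorem makes \<open>F\<close> injective whichever sign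
  \<open>W\<close> has.\<close>

lemma reparametrization:
  fixes W :: "real \<Rightarrow> real"
  assumes I: "open_interval I" and W: "smooth_on I W" "\<And>t. t \<in> I \<Longrightarrow> W t \<noteq> 0"
  obtains J r where "open_interval J" "bij_betw r J I" "smooth_on J r"
    "\<And>s. s \<in> J \<Longrightarrow> (r has_real_derivative 1 / W (r s)) (at s)"
proof -
  obtain F where F: "\<And>t. t \<in> I \<Longrightarrow> (F has_real_derivative W t) (at t)"
    using open_interval_antiderivative[OF I smooth_on_imp_continuous_on[OF W(1)]] by blast
  have Fcont: "continuous_on I F"
    by (rule continuous_at_imp_continuous_on) (use F DERIV_isCont in blast)
  have oI: "open I" "is_interval I" "I \<noteq> {}" using I by (auto simp: open_interval_def)
  have neq: "F a \<noteq> F b" if "a \<in> I" "b \<in> I" "a < b" for a b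
  proof
    assume "F a = F b"
    have sub: "t \<in> I" if "a \<le> t" "t \<le> b" for t
      using oI(2) \<open>a \<in> I\<close> \<open>b \<in> I\<close> that unfolding is_interval_1 by blast
    then obtain z where "a < z" "z < b" "F b - F a = (b - a) * W z"
      using MVT2[OF \<open>a < b\<close>, of F W] F by blast
    then show False using sub[of z] W(2)[of z] \<open>F a = F b\<close> \<open>a < b\<close> by auto
  qed
  then have inj: "inj_on F I"
    unfolding inj_on_def by (metis linorder_cases)
  define J r where "J = F ` I" and "r = inv_into I F"
  have bij: "bij_betw r J I"
    unfolding J_def r_def by (rule bij_betw_inv_into[OF inj_on_imp_bij_betw[OF inj]])
  have oJ: "open J"
    unfolding J_def by (rule injective_into_1d_imp_open_map_UNIV[OF oI(1) Fcont inj order_refl])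
  have "connected J"
    unfolding J_def
    using connected_continuous_image[OF Fcont] oI(2) by (simp add: is_interval_connected_1)
  then have J: "open_interval J"
    using oJ oI(3) by (simp add: open_interval_def is_interval_connected_1 J_def)
  have rI: "r s \<in> I" "F (r s) = s" if "s \<in> J" for s
    using that by (auto simp: r_def J_def inv_into_into f_inv_into_f)
  have der: "(r has_real_derivative 1 / W (r s)) (at s)" if s: "s \<in> J" for s
  proof -
    have "(r has_derivative (\<lambda>h. h / W (r s))) (at s)"
    proof (rule has_derivative_inverse_strong_x[where f = F and f' = "(*) (W (r s))" and S = I])
      show "(F has_derivative (*) (W (r s))) (at (r s))"
        using F[OF rI(1)[OF s]] by (simp add: has_field_derivative_def)
      show "(*) (W (r s)) \<circ> (\<lambda>h. h / W (r s)) = id"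
        using W(2)[OF rI(1)[OF s]] by (auto simp: fun_eq_iff)
      show "r (F t) = t" if "t \<in> I" for t using inj that by (simp add: r_def)
    qed (use oI Fcont rI s in auto)
    then show ?thesis
      by (simp add: has_field_derivative_def divide_inverse mult_commute_abs)
  qed
  \<comment> \<open>Bootstrapping through r' = 1 / W(r): if \<open>r\<close> has order
    \<open>k\<close>, then so does its derivative, and \<open>r\<close> has order
    \<open>k + 1\<close>.\<close>
  have "Ck_on k J r" for k
  proof (induction k)
    case 0
    have "continuous_on J r"
      by (rule continuous_at_imp_continuous_on) (use der DERIV_isCont in blast)
    then show ?case by simp
  next
    case (Suc k)
    have "Ck_on k I (\<lambda>t. 1 / W t * v)" for v
      using W by (intro Ck_on_mult Ck_on_divide Ck_on_const oI) (auto simp: smooth_on_def)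
    then have *: "Ck_on k J (\<lambda>s. 1 / W (r s) * v)" for v
      by (rule Ck_on_compose[OF oJ Suc]) (use rI in auto)
    show ?case
      by (rule Ck_on_SucI[OF oJ der[unfolded has_field_derivative_def] *])
  qed
  then have "smooth_on J r" by (simp add: smooth_on_def)
  with J bij der show ?thesis using that by blast
qed

section \<open>Smooth curves read in charts\<close>

lemma open_curve_domain:
  assumes "smooth_atlas A" "smooth_regular_curve A I \<gamma>" "c \<in> A"
  shows "open {t \<in> I. \<gamma> t \<in> dom c}"
proof -
  have "open I" "continuous_on I \<gamma>"
    using assms(2) by (auto simp: smooth_regular_curve_def open_interval_def)
  moreover have "open (dom c)" using assms(1,3) by (auto simp: smooth_atlas_def)
  ultimately have "open (I \<inter> \<gamma> -` dom c)" by (intro continuous_open_preimage)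
  then show ?thesis by (simp add: vimage_def Int_def)
qed

lemma smooth_curve_derivatives:
  fixes x :: "real \<Rightarrow> real^'n::finite"
  assumes "open S" "smooth_on S x" "t \<in> S"
  shows "(x has_vector_derivative velocity x t) (at t)"
    and "(velocity x has_vector_derivative vector_derivative (velocity x) (at t)) (at t)"
proof -
  have c: "Ck_on (Suc k) S x" for k using assms(2) by (simp add: smooth_on_def)
  then have v: "smooth_on S (velocity x)"
    unfolding smooth_on_def using Ck_on_real_Suc_iff[OF assms(1)] by blast
  show "(x has_vector_derivative velocity x t) (at t)"
    using c[of 0] assms(3) by (simp add: vector_derivative_works)
  show "(velocity x has_vector_derivative vector_derivative (velocity x) (at t)) (at t)"
    using v assms(3) by (metis smooth_on_Suc_iff vector_derivative_works)
qed

lemma one_form_velocity_invariant: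
  assumes A: "smooth_atlas A" "c \<in> A" "d \<in> A" and w: "one_form A \<omega>"
    and \<gamma>: "smooth_regular_curve A I \<gamma>" and t: "t \<in> I" "\<gamma> t \<in> dom c" "\<gamma> t \<in> dom d"
  shows "\<omega> c (coord c (\<gamma> t)) \<bullet> velocity (coord c \<circ> \<gamma>) t =
    \<omega> d (coord d (\<gamma> t)) \<bullet> velocity (coord d \<circ> \<gamma>) t"
proof -
  have sm: "smooth_on {t \<in> I. \<gamma> t \<in> dom c} (coord c \<circ> \<gamma>)"
    using \<gamma> A(2) by (simp add: smooth_regular_curve_def)
  have x: "coord c (\<gamma> t) \<in> coord c ` (dom c \<inter> dom d)" using t by blast
  note T = smooth_on_has_derivative[OF transition_smooth(2)[OF A] x]
  have o: "open {t \<in> I. \<gamma> t \<in> dom c}" "open {t \<in> I. \<gamma> t \<in> dom d}"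
    using open_curve_domain[OF A(1) \<gamma>] A(2,3) by blast+
  have v: "((coord c \<circ> \<gamma>) has_vector_derivative velocity (coord c \<circ> \<gamma>) t) (at t)"
    by (rule smooth_curve_derivatives(1)[OF o(1) sm]) (use t in simp)
  have "((\<lambda>s. transition c d ((coord c \<circ> \<gamma>) s)) has_vector_derivative
      frechet_derivative (transition c d) (at (coord c (\<gamma> t))) (velocity (coord c \<circ> \<gamma>) t)) (at t)"
    by (rule has_vector_derivative_compose[OF _ v]) (use T in simp)
  then have "((coord d \<circ> \<gamma>) has_vector_derivative
      frechet_derivative (transition c d) (at (coord c (\<gamma> t))) (velocity (coord c \<circ> \<gamma>) t)) (at t)"
    by (rule has_vector_derivative_transform_within_open[OF _ open_Int[OF o]])
      (use t in \<open>auto simp: transition_coord[OF A(1,2)]\<close>)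
  then have "velocity (coord d \<circ> \<gamma>) t =
      frechet_derivative (transition c d) (at (coord c (\<gamma> t))) (velocity (coord c \<circ> \<gamma>) t)"
    by (rule vector_derivative_at)
  then show ?thesis
    using one_form_transformation[OF A w x] transition_coord[OF A(1,2) t(2), of d] by simp
qed

lemma smooth_one_form_velocity:
  assumes A: "smooth_atlas A" "c \<in> A" and w: "one_form A \<omega>" and \<gamma>: "smooth_regular_curve A I \<gamma>"
  shows "smooth_on {t \<in> I. \<gamma> t \<in> dom c}
    (\<lambda>t. \<omega> c (coord c (\<gamma> t)) \<bullet> velocity (coord c \<circ> \<gamma>) t)"
  unfolding smooth_on_def
proof
  fix k
  let ?S = "{t \<in> I. \<gamma> t \<in> dom c}"
  have o: "open ?S" by (rule open_curve_domain[OF A(1) \<gamma> A(2)])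
  have sm: "smooth_on ?S (coord c \<circ> \<gamma>)" using \<gamma> A(2) by (simp add: smooth_regular_curve_def)
  have v: "Ck_on (Suc k) ?S (coord c \<circ> \<gamma>)" using sm unfolding smooth_on_def by blast
  have "Ck_on k (img c) (\<omega> c)" using w A(2) by (simp add: one_form_def smooth_on_def)
  then have "Ck_on k ?S (\<lambda>t. \<omega> c ((coord c \<circ> \<gamma>) t))"
    by (rule Ck_on_compose[OF o Ck_on_Suc_imp_Ck_on[OF v]]) (auto simp: img_def)
  moreover have "Ck_on k ?S (velocity (coord c \<circ> \<gamma>))"
    using v unfolding Ck_on_real_Suc_iff[OF o] by simp
  ultimately have "Ck_on k ?S (\<lambda>t. \<omega> c ((coord c \<circ> \<gamma>) t) \<bullet> velocity (coord c \<circ> \<gamma>) t)"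
    by (rule Ck_on_inner[OF o])
  then show "Ck_on k ?S (\<lambda>t. \<omega> c (coord c (\<gamma> t)) \<bullet> velocity (coord c \<circ> \<gamma>) t)" by simp
qed

text \<open>A geodesic need not stay in one chart, yet the change of parameter needs
  \<omega>(\<gamma>') as one function on \<open>I\<close>. A chart is chosen for every parameter; by
  chart independence, \<open>W\<close> equals near each \<open>t\<close> the smooth expression in
  the fixed chart \<open>ch t\<close>.\<close>

lemma kropina_geodesic_weight:
  assumes A: "smooth_atlas A" and w: "one_form A \<omega>" and \<gamma>: "kropina_geodesic A g \<omega> I \<gamma>"
  obtains W where "smooth_on I W" "\<And>t. t \<in> I \<Longrightarrow> W t \<noteq> 0"
    "\<And>c t. c \<in> A \<Longrightarrow> t \<in> I \<Longrightarrow> \<gamma> t \<in> dom c \<Longrightarrow>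
      W t = \<omega> c (coord c (\<gamma> t)) \<bullet> velocity (coord c \<circ> \<gamma>) t"
proof -
  have reg: "smooth_regular_curve A I \<gamma>" using \<gamma> by (simp add: kropina_geodesic_def)
  define ch where "ch = (\<lambda>t. SOME c. c \<in> A \<and> \<gamma> t \<in> dom c)"
  have ch: "ch t \<in> A \<and> \<gamma> t \<in> dom (ch t)" for t
  proof -
    have "\<gamma> t \<in> (\<Union>c\<in>A. dom c)" using A unfolding smooth_atlas_def by simp
    then have "\<exists>c. c \<in> A \<and> \<gamma> t \<in> dom c" by blast
    then show ?thesis unfolding ch_def by (rule someI_ex)
  qed
  define W where "W = (\<lambda>t. \<omega> (ch t) (coord (ch t) (\<gamma> t)) \<bullet> velocity (coord (ch t) \<circ> \<gamma>) t)"
  have W: "W t = \<omega> c (coord c (\<gamma> t)) \<bullet> velocity (coord c \<circ> \<gamma>) t"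
    if "c \<in> A" "t \<in> I" "\<gamma> t \<in> dom c" for c t
    unfolding W_def using one_form_velocity_invariant[OF A _ that(1) w reg that(2) _ that(3)] ch by blast
  have "Ck_on k I W" for k
  proof (rule Ck_on_local)
    fix t assume t: "t \<in> I"
    let ?S = "{s \<in> I. \<gamma> s \<in> dom (ch t)}"
    have o: "open ?S" using open_curve_domain[OF A reg] ch by blast
    have "Ck_on k ?S (\<lambda>s. \<omega> (ch t) (coord (ch t) (\<gamma> s)) \<bullet> velocity (coord (ch t) \<circ> \<gamma>) s)"
      using smooth_one_form_velocity[OF A _ w reg, of "ch t"] ch unfolding smooth_on_def by blast
    then have "Ck_on k ?S W"
      by (rule Ck_on_cong[OF o]) (use W[of "ch t"] ch in simp)
    then show "\<exists>U. open U \<and> t \<in> U \<and> Ck_on k U W" using o t ch by blast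
  qed
  then have "smooth_on I W" by (simp add: smooth_on_def)
  moreover have "W t \<noteq> 0" if "t \<in> I" for t
    using \<gamma> that ch[of t] unfolding kropina_geodesic_def W_def by blast
  ultimately show ?thesis using W that by blast
qed

lemma closed_one_form_derivative_symmetric:
  assumes "closed_one_form A \<omega>" "c \<in> A" "x \<in> img c"
  shows "frechet_derivative (\<omega> c) (at x) u \<bullet> v = frechet_derivative (\<omega> c) (at x) v \<bullet> u"
proof -
  let ?D = "frechet_derivative (\<omega> c) (at x)"
  have d: "(\<omega> c has_derivative ?D) (at x)"
    using assms smooth_on_has_derivative unfolding closed_one_form_def one_form_def by blast
  have p: "partial i (\<lambda>z. \<omega> c z $ j) x = ?D (axis i 1) $ j" for i j
    unfolding partial_def
    using frechet_derivative_at[OF bounded_linear.has_derivative[OF bounded_linear_vec_nth d], of j] by metis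
  have s: "?D (axis i 1) $ j = ?D (axis j 1) $ i" for i j
    using assms p unfolding closed_one_form_def by metis
  have e: "?D u \<bullet> v = (\<Sum>i\<in>UNIV. \<Sum>j\<in>UNIV. u $ i * v $ j * ?D (axis i 1) $ j)" for u v
  proof -
    have "linear (\<lambda>u. ?D u \<bullet> v)" "linear (\<lambda>v. ?D u \<bullet> v)" for u v
      using has_derivative_linear[OF d]
      by (auto intro!: linearI simp: linear_add linear_cmul inner_add_left inner_add_right)
    from bilinear_expansion_axis[OF this, of u v] show ?thesis by (simp add: inner_axis)
  qed
  show ?thesis
    unfolding e[of u v] e[of v u]
    by (subst (2) sum.swap) (intro sum.cong refl, subst s, simp add: mult_ac)
qed

text \<open>The factor W' / W is built from one function \<open>W\<close> shared by all charts, so a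
  single change of parameter removes it everywhere.\<close>

lemma kropina_geodesic_pregeodesic:
  assumes A: "smooth_atlas A" and k: "kropina_data A g \<omega>" and cl: "closed_one_form A \<omega>"
    and \<gamma>: "kropina_geodesic A g \<omega> I \<gamma>" and c: "c \<in> A" and t: "t \<in> I" "\<gamma> t \<in> dom c"
    and W: "\<And>c t. c \<in> A \<Longrightarrow> t \<in> I \<Longrightarrow> \<gamma> t \<in> dom c \<Longrightarrow>
      W t = \<omega> c (coord c (\<gamma> t)) \<bullet> velocity (coord c \<circ> \<gamma>) t"
    and W': "(W has_real_derivative W') (at t)"
  defines "x \<equiv> coord c \<circ> \<gamma>"
  shows "vector_derivative (velocity x) (at t)
    + kropina_nabla (g c) (\<omega> c) (x t) (velocity x t) (velocity x t) = (W' / W t) *\<^sub>R velocity x t"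
proof -
  let ?S = "{t \<in> I. \<gamma> t \<in> dom c}"
  have reg: "smooth_regular_curve A I \<gamma>" using \<gamma> by (simp add: kropina_geodesic_def)
  have o: "open ?S" by (rule open_curve_domain[OF A reg c])
  have tS: "t \<in> ?S" using t by simp
  have sm: "smooth_on ?S x" using reg c by (simp add: smooth_regular_curve_def x_def)
  have im: "x s \<in> img c" if "s \<in> ?S" for s using that by (simp add: x_def img_def)
  have "smooth_on (img c) (g c)" "smooth_on (img c) (\<omega> c)"
    using k c by (auto simp: kropina_data_def symmetric_2_tensor_def one_form_def)
  then have diff: "g c differentiable (at (x t))" "\<omega> c differentiable (at (x t))"
    using im[OF tS] smooth_on_Suc_iff by blast+
  have W0: "\<omega> c (x s) \<bullet> velocity x s \<noteq> 0" if "s \<in> ?S" for s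
    using \<gamma> c that by (simp add: kropina_geodesic_def x_def)
  have dW: "((\<lambda>s. \<omega> c (x s) \<bullet> velocity x s) has_real_derivative W') (at t)"
    by (rule has_field_derivative_transform_within_open[OF W' o tS]) (use W c in \<open>simp add: x_def\<close>)
  have EL: "euler_lagrange_at (kropina g \<omega> c) x t"
    using \<gamma> c t by (simp add: kropina_geodesic_def x_def)
  have "W t = \<omega> c (x t) \<bullet> velocity x t" using W[OF c t] by (simp add: x_def)
  then show ?thesis
    using kropina_euler_lagrange_imp_nabla[of ?S t \<omega> c x g, OF o tS W0 _ diff
        closed_one_form_derivative_symmetric[OF cl c im[OF tS]]
        smooth_curve_derivatives(1,2)[OF o sm tS] dW EL]
      kropina_data_nondegenerate[OF k c im] by simp
qed

theorem kropina_geodesic_imp_unparameterized_geodesic: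
  assumes A: "smooth_atlas A" and k: "kropina_data A g \<omega>" and cl: "closed_one_form A \<omega>"
    and \<gamma>: "kropina_geodesic A g \<omega> I \<gamma>"
  shows "unparameterized_geodesic A (kropina_connection g \<omega>) I \<gamma>"
proof -
  have w: "one_form A \<omega>" using k by (simp add: kropina_data_def)
  have reg: "smooth_regular_curve A I \<gamma>" using \<gamma> by (simp add: kropina_geodesic_def)
  have I: "open_interval I" "open I" "continuous_on I \<gamma>"
    using reg by (auto simp: smooth_regular_curve_def open_interval_def)
  obtain W where Wsm: "smooth_on I W" and W0: "\<And>t. t \<in> I \<Longrightarrow> W t \<noteq> 0"
    and W: "\<And>c t. c \<in> A \<Longrightarrow> t \<in> I \<Longrightarrow> \<gamma> t \<in> dom c \<Longrightarrow>
      W t = \<omega> c (coord c (\<gamma> t)) \<bullet> velocity (coord c \<circ> \<gamma>) t"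
    using kropina_geodesic_weight[OF A w \<gamma>] by blast
  obtain J r where J: "open_interval J" and r: "bij_betw r J I" "smooth_on J r"
    and dr: "\<And>s. s \<in> J \<Longrightarrow> (r has_real_derivative 1 / W (r s)) (at s)"
    using reparametrization[OF I(1) Wsm W0] by blast
  have rI: "r s \<in> I" if "s \<in> J" for s using r(1) that by (auto simp: bij_betw_def)
  have oJ: "open J" using J by (simp add: open_interval_def)
  have rc: "continuous_on J r" by (rule smooth_on_imp_continuous_on[OF r(2)])
  have drv: "(r has_vector_derivative 1 / W (r s)) (at s)" if "s \<in> J" for s
    using dr[OF that] by (simp add: has_real_derivative_iff_has_vector_derivative)
  have \<gamma>r: "continuous_on J (\<gamma> \<circ> r)"
    by (rule continuous_on_compose[OF rc]) (use I(3) rI in \<open>auto intro: continuous_on_subset\<close>)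
  have oS: "open {s \<in> J. (\<gamma> \<circ> r) s \<in> dom c}" if "c \<in> A" for c
  proof -
    have "open (J \<inter> (\<gamma> \<circ> r) -` dom c)"
      by (rule continuous_open_preimage[OF \<gamma>r oJ]) (use A that in \<open>simp add: smooth_atlas_def\<close>)
    then show ?thesis by (simp add: vimage_def Int_def)
  qed
  have vel: "((coord c \<circ> (\<gamma> \<circ> r)) has_vector_derivative
      (1 / W (r s)) *\<^sub>R velocity (coord c \<circ> \<gamma>) (r s)) (at s)"
    if c: "c \<in> A" and s: "s \<in> J" "\<gamma> (r s) \<in> dom c" for c s
  proof -
    have sm: "smooth_on {t \<in> I. \<gamma> t \<in> dom c} (coord c \<circ> \<gamma>)"
      using reg c by (simp add: smooth_regular_curve_def)
    have "r s \<in> {t \<in> I. \<gamma> t \<in> dom c}" using rI s by simp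
    from smooth_curve_derivatives(1)[OF open_curve_domain[OF A reg c] sm this]
    show ?thesis
      using vector_diff_chain_at[OF drv[OF s(1)]] by (simp add: o_assoc)
  qed
  have regr: "smooth_regular_curve A J (\<gamma> \<circ> r)"
    unfolding smooth_regular_curve_def
  proof (intro conjI ballI impI J \<gamma>r)
    fix c assume c: "c \<in> A"
    have "Ck_on k {s \<in> J. (\<gamma> \<circ> r) s \<in> dom c} (\<lambda>s. (coord c \<circ> \<gamma>) (r s))" for k
    proof (rule Ck_on_compose[OF oS[OF c], where f = r and h = "coord c \<circ> \<gamma>"])
      show "Ck_on k {s \<in> J. (\<gamma> \<circ> r) s \<in> dom c} r"
        using r(2) by (auto simp: smooth_on_def intro: Ck_on_subset)
      show "Ck_on k {t \<in> I. \<gamma> t \<in> dom c} (coord c \<circ> \<gamma>)"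
        using reg c by (simp add: smooth_regular_curve_def smooth_on_def)
    qed (use rI in auto)
    then show "smooth_on {s \<in> J. (\<gamma> \<circ> r) s \<in> dom c} (coord c \<circ> (\<gamma> \<circ> r))"
      by (simp add: smooth_on_def o_def)
    fix s assume s: "s \<in> J" "(\<gamma> \<circ> r) s \<in> dom c"
    have "velocity (coord c \<circ> \<gamma>) (r s) \<noteq> 0"
      using reg c rI s by (simp add: smooth_regular_curve_def)
    then show "velocity (coord c \<circ> (\<gamma> \<circ> r)) s \<noteq> 0"
      using vector_derivative_at[OF vel[OF c s(1)]] s(2) W0[OF rI[OF s(1)]] by simp
  qed
  have "parameterized_geodesic A (kropina_connection g \<omega>) J (\<gamma> \<circ> r)"
    unfolding parameterized_geodesic_def Let_def
  proof (intro conjI regr ballI impI allI)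
    fix c s l assume c: "c \<in> A" and s: "s \<in> J" "(\<gamma> \<circ> r) s \<in> dom c"
    define x \<xi> a where "x = coord c \<circ> \<gamma>" and "\<xi> = velocity x (r s)"
      and "a = vector_derivative (velocity x) (at (r s))"
    define y where "y = coord c \<circ> (\<gamma> \<circ> r)"
    define u where "u = 1 / W (r s)"
    have yx: "y s = x (r s)" by (simp add: y_def x_def)
    have t: "r s \<in> I" "\<gamma> (r s) \<in> dom c" using rI s by auto
    have u0: "W (r s) \<noteq> 0" by (rule W0[OF t(1)])
    obtain W' where W': "(W has_real_derivative W') (at (r s))"
      using Wsm t(1) smooth_on_Suc_iff by (metis real_differentiableE)
    have sm: "smooth_on {t \<in> I. \<gamma> t \<in> dom c} x"
      using reg c by (simp add: smooth_regular_curve_def x_def)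
    have a: "(velocity x has_vector_derivative a) (at (r s))"
      unfolding a_def
      by (rule smooth_curve_derivatives(2)[OF open_curve_domain[OF A reg c] sm]) (use t in simp)
    have \<eta>: "velocity y s' = (1 / W (r s')) *\<^sub>R velocity x (r s')"
      if "s' \<in> {s \<in> J. (\<gamma> \<circ> r) s \<in> dom c}" for s'
      using vector_derivative_at[OF vel[OF c]] that by (simp add: x_def y_def)
    \<comment> \<open>With u = 1 / W(r s) = r'(s), the chain rule gives - W' r' / W(r s)^2 = - u^3
      W'.\<close>
    have "((\<lambda>s. 1 / W (r s)) has_real_derivative - (u * W') * u * u) (at s)"
      using DERIV_inverse'[OF DERIV_chain2[OF W' dr[OF s(1)]] u0]
      by (simp add: u_def divide_inverse mult_ac)
    from has_vector_derivative_scaleR[OF this vector_diff_chain_at[OF drv[OF s(1)] a]]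
    have "((\<lambda>s. (1 / W (r s)) *\<^sub>R velocity x (r s)) has_vector_derivative
        u *\<^sub>R u *\<^sub>R a - (u * W' * u * u) *\<^sub>R \<xi>) (at s)"
      by (simp add: o_def u_def \<xi>_def)
    then have "(velocity y has_vector_derivative u *\<^sub>R u *\<^sub>R a - (u * W' * u * u) *\<^sub>R \<xi>) (at s)"
      by (rule has_vector_derivative_transform_within_open[OF _ oS[OF c]]) (use s \<eta> in auto)
    then have acc: "vector_derivative (velocity y) (at s) = u *\<^sub>R u *\<^sub>R a - (u * W' * u * u) *\<^sub>R \<xi>"
      by (rule vector_derivative_at)
    have xim: "x (r s) \<in> img c" using t by (simp add: x_def img_def)
    have "smooth_on (img c) (g c)" "smooth_on (img c) (\<omega> c)"
      using k c by (auto simp: kropina_data_def symmetric_2_tensor_def one_form_def)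
    then have diff: "g c differentiable (at (x (r s)))" "\<omega> c differentiable (at (x (r s)))"
      using xim smooth_on_Suc_iff by blast+
    define N where "N = kropina_nabla (g c) (\<omega> c) (x (r s)) \<xi> \<xi>"
    have "(\<Sum>i\<in>UNIV. \<Sum>j\<in>UNIV. kropina_connection g \<omega> c (x (r s)) $ i $ j $ l * \<xi> $ i * \<xi> $ j) = N $ l"
      unfolding N_def
      by (subst kropina_nabla_expansion[of "g c" "x (r s)" "\<omega> c",
            OF kropina_data_nondegenerate[OF k c xim] diff, symmetric])
        (simp add: kropina_connection_def mult_ac)
    moreover have "(\<Sum>i\<in>UNIV. \<Sum>j\<in>UNIV. kropina_connection g \<omega> c (y s) $ i $ j $ l
        * velocity y s $ i * velocity y s $ j) =
      u * u * (\<Sum>i\<in>UNIV. \<Sum>j\<in>UNIV. kropina_connection g \<omega> c (x (r s)) $ i $ j $ l * \<xi> $ i * \<xi> $ j)"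
      using \<eta>[of s] s by (simp add: yx u_def \<xi>_def sum_distrib_left mult_ac)
    moreover have "a + N = (u * W') *\<^sub>R \<xi>"
      using kropina_geodesic_pregeodesic[OF A k cl \<gamma> c t W W']
      by (simp add: a_def N_def x_def \<xi>_def u_def)
    then have "a $ l + N $ l = u * W' * \<xi> $ l"
      by (metis vector_add_component vector_scaleR_component real_scaleR_def)
    then have "u * u * (a $ l + N $ l) = u * u * (u * W' * \<xi> $ l)" by simp
    \<comment> \<open>Here y'' = u^2 a - u^3 W' \<xi>, and the connection term is u^2 N; the sum u^2
      (a + N - u W' \<xi>) vanishes by the equation for a + N.\<close>
    ultimately have "vector_derivative (velocity y) (at s) $ l
      + (\<Sum>i\<in>UNIV. \<Sum>j\<in>UNIV. kropina_connection g \<omega> c (y s) $ i $ j $ l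
        * velocity y s $ i * velocity y s $ j) = 0"
      by (simp add: acc algebra_simps)
    then show "vector_derivative (velocity (coord c \<circ> (\<gamma> \<circ> r))) (at s) $ l
      + (\<Sum>i\<in>UNIV. \<Sum>j\<in>UNIV. kropina_connection g \<omega> c ((coord c \<circ> (\<gamma> \<circ> r)) s) $ i $ j $ l
        * velocity (coord c \<circ> (\<gamma> \<circ> r)) s $ i * velocity (coord c \<circ> (\<gamma> \<circ> r)) s $ j) = 0"
      by (simp only: y_def)
  qed
  moreover have "vector_derivative r (at s) \<noteq> 0" if "s \<in> J" for s
    using vector_derivative_at[OF drv[OF that]] W0[OF rI[OF that]] by simp
  ultimately show ?thesis
    unfolding unparameterized_geodesic_def using reg J r by blast
qed

theorem theorem1p4:
  fixes A :: "('m::{t2_space, second_countable_topology}, 'n::finite) chart set"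
    and g :: "('m, 'n) chart \<Rightarrow> real^'n \<Rightarrow> real^'n^'n"
    and \<omega> :: "('m, 'n) chart \<Rightarrow> real^'n \<Rightarrow> real^'n"
  assumes "smooth_atlas A"
    and "kropina_data A g \<omega>"
    and "closed_one_form A \<omega>"
  shows "\<exists>\<Gamma>. affine_connection A \<Gamma> \<and>
    (\<forall>I \<gamma>. kropina_geodesic A g \<omega> I \<gamma> \<longrightarrow> unparameterized_geodesic A \<Gamma> I \<gamma>)"
  using affine_connection_kropina[OF assms(1,2)]
    kropina_geodesic_imp_unparameterized_geodesic[OF assms] by blast

end
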